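(* Let $m \ge 4$ and let $(W_n)_{n\ge 0}$ be the signed random heap process with $m$ columns (equivalently, the random walk on the locally free group with $m$ generators and periodic boundary conditions), started from the empty heap. Let $\#T(W_n)$ be the number of pieces in the roof of $W_n$. Then $$\lim_{n\to\infty}\frac{1}{m}\,\mathbb{E}\big(\#T(W_n)\big)\le 0.32893$$ (in particular the limit exists).
   Context: Signed random heap process with $m$ columns. Columns are indexed by $\mathbb{Z}_m$ (integers mod $m$). A piece is a triple (height, column, sign) with height in $\{1,2,\dots\}$, column in $\mathbb{Z}_m$, sign in $\{+,-\}$. $W_0$ is the empty heap. Given $W_n$, let $h_j$ be the height of the highest piece in column $j$ and $s_j$ its sign, with $h_j=0$ if column $j$ is empty. A column $k\in\mathbb{Z}_m$ and sign $s\in\{+,-\}$ are chosen uniformly among the $2m$ possibilities, independently of the past, and a piece is "dropped" (it "falls") in column $k$: if $h_k>\max\{h_{k-1},h_{k+1}\}$ and $s_k\ne s$, then the new piece and the piece $(h_k,k,s_k)$ annihilate (the latter is removed and nothing is added); otherwise the piece $(\max\{h_{k-1},h_k,h_{k+1}\}+1,\,k,\,s)$ is added. The result is $W_{n+1}$. This corresponds to the simple random walk, started at the identity and with steps uniform on $\{g_i^{\pm1}\}$, on the group $\langle g_0,\dots,g_{m-1} : g_ig_j=g_jg_i \ \forall\, i\ne j\pm1 \bmod m\rangle$: dropping a $+$ (resp. $-$) piece in column $k$ corresponds to multiplying by $g_k$ (resp. $g_k^{-1}$). A piece of a heap is removable if there is no piece at greater height in its own column or in either of the two adjacent columns. The roof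 $T(W)$ of a heap $W$ is the set of its removable pieces. *)

theory Defs
  imports "HOL-Probability.Probability"
begin

(* Columns are the representatives 0, ..., m - 1 of the integers mod m; the sign + is True. *)
type_synonym piece = "nat \<times> int \<times> bool"
type_synonym heap = "piece set"

definition heap_columns :: "nat \<Rightarrow> int set" where
  "heap_columns m = {0..<int m}"

definition col_left :: "nat \<Rightarrow> int \<Rightarrow> int" where
  "col_left m k = (k - 1) mod int m"

definition col_right :: "nat \<Rightarrow> int \<Rightarrow> int" where
  "col_right m k = (k + 1) mod int m"

definition col_height :: "heap \<Rightarrow> int \<Rightarrow> nat" where
  "col_height W j = Max (insert 0 {h. \<exists>s. (h, j, s) \<in> W})"

(* Only meaningful for a nonempty column; in a heap built by dropping pieces,
   a cell carries at most one piece, so the sign is unique. *)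
definition top_sign :: "heap \<Rightarrow> int \<Rightarrow> bool" where
  "top_sign W j = (THE s. (col_height W j, j, s) \<in> W)"

definition drop_piece :: "nat \<Rightarrow> heap \<Rightarrow> int \<times> bool \<Rightarrow> heap" where
  "drop_piece m W = (\<lambda>(k, s).
     let hl = col_height W (col_left m k);
         h = col_height W k;
         hr = col_height W (col_right m k)
     in if h > max hl hr \<and> top_sign W k \<noteq> s
        then W - {(h, k, top_sign W k)}
        else insert (max hl (max h hr) + 1, k, s) W)"

(* X n is the choice of column and sign that takes W n to W (Suc n). Every W n is a function
   of X 0, ..., X (n - 1), so mutual independence of the X n says that each choice is
   independent of the past. *)
definition signed_heap_process :: "nat \<Rightarrow> 'a measure \<Rightarrow> (nat \<Rightarrow> 'a \<Rightarrow> heap) \<Rightarrow> bool" where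
  "signed_heap_process m M W \<longleftrightarrow> prob_space M \<and>
     (\<exists>X :: nat \<Rightarrow> 'a \<Rightarrow> int \<times> bool.
        prob_space.indep_vars M (\<lambda>_. count_space UNIV) X UNIV \<and>
        (\<forall>n. distr M (count_space UNIV) (X n) =
             measure_pmf (pmf_of_set (heap_columns m \<times> (UNIV :: bool set)))) \<and>
        (\<forall>\<omega>\<in>space M. W 0 \<omega> = {}) \<and>
        (\<forall>n. \<forall>\<omega>\<in>space M. W (Suc n) \<omega> = drop_piece m (W n \<omega>) (X n \<omega>)))"

lemma signed_heap_process_exists:
  shows "\<exists>(M :: (nat \<Rightarrow> int \<times> bool) measure) W. signed_heap_process m M W"
proof -
  let ?p = "pmf_of_set (heap_columns m \<times> (UNIV :: bool set))"
  let ?M = "PiM UNIV (\<lambda>_::nat. measure_pmf ?p)"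
  define W where "W = (\<lambda>n \<omega>. rec_nat {} (\<lambda>i w. drop_piece m w (\<omega> i)) n)"
  interpret prob_space ?M by (intro prob_space_PiM prob_space_measure_pmf)
  have d: "distr ?M (count_space UNIV) (\<lambda>\<omega>. \<omega> n) = measure_pmf ?p" for n
  proof -
    have "distr ?M (count_space UNIV) (\<lambda>\<omega>. \<omega> n) = distr ?M (measure_pmf ?p) (\<lambda>\<omega>. \<omega> n)"
      by (intro distr_cong) auto
    also have "\<dots> = measure_pmf ?p" by (rule distr_PiM_component) (auto intro: prob_space_measure_pmf)
    finally show ?thesis .
  qed
  have s: "sets (PiM UNIV (\<lambda>_::nat. count_space UNIV)) = sets ?M"
    by (intro sets_PiM_cong) auto
  have rv: "(\<lambda>\<omega>. \<omega> n) \<in> ?M \<rightarrow>\<^sub>M count_space UNIV" for n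
    using measurable_component_singleton[of n UNIV "\<lambda>_. measure_pmf ?p"] 
    by (simp cong: measurable_cong_sets)
  have "indep_vars (\<lambda>_. count_space UNIV) (\<lambda>n \<omega>. \<omega> n) UNIV"
    by (subst indep_vars_iff_distr_eq_PiM)
       (auto simp: rv d restrict_UNIV distr_id2 s)
  thus ?thesis
    by (intro exI[of _ ?M] exI[of _ W])
       (auto simp: signed_heap_process_def W_def d prob_space_axioms intro!: exI[of _ "\<lambda>n \<omega>. \<omega> n"])
qed

definition removable :: "nat \<Rightarrow> heap \<Rightarrow> piece \<Rightarrow> bool" where
  "removable m W = (\<lambda>(h, k, s).
     \<not> (\<exists>(h', k', s') \<in> W. k' \<in> {col_left m k, k, col_right m k} \<and> h' > h))"

definition roof :: "nat \<Rightarrow> heap \<Rightarrow> heap" where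
  "roof m W = {p \<in> W. removable m W p}"

end

theory Submission
  imports Defs "HOL-Library.Sublist"
begin

text \<open>
  The expected size of the roof satisfies a drift equation. A drop in a column outside the roof adds
  one roof piece and covers the neighbouring ones; an annihilation removes one roof piece and
  uncovers the pieces below it. With \<open>t = E #T / m\<close> this gives, in the stationary regime,
  \<open>7/2 t = 1 + a/2\<close>, where \<open>a\<close> is the density of pairs of a roof piece and a piece uncovered by its
  removal. Bounding \<open>a\<close> needs the drifts of a few further local patterns near the roof. A suitable
  linear combination of the roof size and these pattern counts is bounded, for each \<open>m\<close>, and has
  drift at most \<open>1 - 3.041 #T / m\<close> in every state; hence the limit is at most \<open>1 / 3.041\<close>.

  For the existence of the limit, compare the walk driven by \<open>x\<^sub>0 x\<^sub>1 \<dots> x\<^sub>n\<close> with the one driven by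
  \<open>x\<^sub>1 \<dots> x\<^sub>n\<close>. At all times one heap arises from the other by putting a single piece underneath.
  Their roofs differ only if two adjacent columns are empty, which has exponentially small
  probability because the projection of the walk to the free group generated by two adjacent
  generators drifts to infinity.
\<close>

section \<open>Drift of local patterns\<close>

text \<open>
  The heap is encoded by its edge words: \<open>E e\<close> lists, from the top down, the pieces in the columns
  \<open>e\<close> and \<open>e + 1\<close>, with \<open>True\<close> for the left column. The word of the edge between \<open>k\<close> and \<open>k + d\<close>
  (\<open>d\<close> is 1 or -1), with \<open>True\<close> for column \<open>k\<close>, is \<open>view E k d\<close>. Columns are integers, and states
  are periodic functions.
\<close>

definition view :: "(int \<Rightarrow> bool list) \<Rightarrow> int \<Rightarrow> int
  \<Rightarrow> bool list" where
  "view E k d = (if d = 1 then E k else map Not (E (k - 1)))"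

text \<open>The words of four consecutive edges, the first one behind \<open>k\<close> and the
  others ahead of it in direction \<open>d\<close>; \<open>True\<close> is the end nearer to
  \<open>k\<close> (\<open>k\<close> itself in \<open>p\<close> and \<open>q\<close>). The direction
  lets mirror images share one definition. As \<open>m\<close> is at least 4, the four edges are
  distinct.\<close>

definition pat :: "(int \<Rightarrow> bool list) \<Rightarrow> int \<Rightarrow> int \<Rightarrow> bool list
  \<Rightarrow> bool list \<Rightarrow> bool list \<Rightarrow> bool list \<Rightarrow> bool" where
  "pat E k d p q r s \<longleftrightarrow> prefix p (view E k (-d)) \<and> prefix q (view E k d) \<and>
     prefix r (view E (k + d) d) \<and> prefix s (view E (k + 2 * d) d)"

text \<open>
  \<open>exposed\<close>: the top piece of column \<open>k\<close> is in the roof. Removing it uncovers the next piece of the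
  same column (\<open>doubled\<close>) or the top piece of column \<open>k + d\<close> (\<open>over\<close>). In the case \<open>chained\<close>,
  removing the piece uncovered by \<open>over\<close> in turn uncovers two pieces, the most that is possible.
  \<open>bridged\<close>: the top piece of column \<open>k\<close> is covered by exactly two roof pieces, one on each side.
\<close>

abbreviation "exposed E k \<equiv> pat E k 1 [True] [True] [] []"
abbreviation "doubled E k \<equiv> pat E k 1 [True,True] [True,True] [] []"
abbreviation "over E k d \<equiv> pat E k d [True] [True,False] [True] []"
abbreviation "bridged E k \<equiv> pat E (k - 1) 1 [True] [True,False] [False,True] [True]"
abbreviation "chained E k d \<equiv> pat E k d [True,True] [True,False,True] [True,False] [True]"

locale four_columns =
  fixes m :: nat
  assumes m4: "m \<ge> 4"
begin

definition push :: "int \<Rightarrow> (int \<Rightarrow> bool list) \<Rightarrow> int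
  \<Rightarrow> bool list" where
  "push c E = (\<lambda>e. if int m dvd e - c then True # E e
                   else if int m dvd e + 1 - c then False # E e else E e)"

definition pop :: "int \<Rightarrow> (int \<Rightarrow> 'b list) \<Rightarrow> int
  \<Rightarrow> 'b list" where
  "pop c E = (\<lambda>e. if int m dvd e - c \<or> int m dvd e + 1 - c then tl (E e) else E e)"

text \<open>
  The change of \<open>f\<close> under a drop in column \<open>c\<close>, averaged over the sign of the piece. Exactly one of
  the two signs annihilates at an exposed column, so the signs need not be recorded.
\<close>

definition gen :: "((int \<Rightarrow> bool list) \<Rightarrow> real) \<Rightarrow> (int
  \<Rightarrow> bool list) \<Rightarrow> int \<Rightarrow> real" where
  "gen f E c = (if exposed E c then (f (push c E) + f (pop c E)) / 2 else f (push c E)) - f E"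

lemma prefix_Cons_iff: "prefix (x # p) l \<longleftrightarrow> l \<noteq> [] \<and> hd l = x
  \<and> prefix p (tl l)"
  by (cases l) auto

lemma prefix_map_Not: "prefix p (map Not l) \<longleftrightarrow> prefix (map Not p) l"
proof (induction p arbitrary: l)
  case (Cons x p)
  then show ?case by (cases l) auto
qed simp

text \<open>The columns that matter to one pattern are at most four apart. With
  \<open>m \<ge> 4\<close>, two of them coincide modulo \<open>m\<close> only at distance 4, and
  only if \<open>m = 4\<close>; this decides which edge words a drop changes.\<close>

lemma dvd_small:
  "\<not> int m dvd 1" "\<not> int m dvd 2" "\<not> int m dvd 3" "int m dvd 4 \<longleftrightarrow> m = 4"
  "\<not> int m dvd -1" "\<not> int m dvd -2" "\<not> int m dvd -3" "int m dvd -4 \<longleftrightarrow> m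
    = 4"  "m \<noteq> Suc 0"
  using m4 zdvd_imp_le[of "int m" 1] zdvd_imp_le[of "int m" 2] zdvd_imp_le[of "int m" 3] zdvd_imp_le[of "int m" 4]
  by auto

lemmas pat_simps = pat_def view_def prefix_map_Not prefix_Cons_iff


lemmas gen_simps = pat_simps gen_def push_def pop_def dvd_small algebra_simps

section \<open>Total drift and sums over a period\<close>

definition drift :: "((int \<Rightarrow> bool list) \<Rightarrow> real) \<Rightarrow> (int
  \<Rightarrow> bool list) \<Rightarrow> real" where
  "drift f E = (\<Sum>c\<in>{0..<int m}. gen f E c)"

definition periodic :: "(int \<Rightarrow> 'b) \<Rightarrow> bool" where
  "periodic g \<longleftrightarrow> (\<forall>e. g (e + int m) = g e)"

lemma sum_periodic_step:
  fixes g :: "int \<Rightarrow> real"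
  assumes "periodic g"
  shows "(\<Sum>c\<in>{a + 1..<a + 1 + int m}. g c) = (\<Sum>c\<in>{a..<a + int m}. g c)"
proof -
  have "{a..<a + int m} = insert a {a + 1..<a + int m}"
    and "{a + 1..<a + 1 + int m} = insert (a + int m) {a + 1..<a + int m}"
    using m4 by auto
  then show ?thesis
    using assms by (simp add: periodic_def)
qed

lemma sum_periodic:
  fixes g :: "int \<Rightarrow> real"
  assumes "periodic g"
  shows "(\<Sum>c\<in>{a..<a + int m}. g c) = (\<Sum>c\<in>{0..<int m}. g c)"
proof (induction a rule: int_induct[where k = 0])
  case (step1 i)
  then show ?case using sum_periodic_step[OF assms, of i] by simp
next
  case (step2 i)
  then show ?case using sum_periodic_step[OF assms, of "i - 1"] by simp
qed simp

lemma sum_periodic_shift: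
  fixes g :: "int \<Rightarrow> real"
  assumes "periodic g"
  shows "(\<Sum>c\<in>{0..<int m}. g (c + a)) = (\<Sum>c\<in>{0..<int m}. g c)"
proof -
  have "(\<Sum>c\<in>{0..<int m}. g (c + a)) = (\<Sum>c\<in>{a..<a + int m}. g c)"
    by (rule sum.reindex_bij_witness[where i = "\<lambda>c. c - a" and j = "\<lambda>c. c + a"]) auto
  then show ?thesis using sum_periodic[OF assms] by simp
qed

lemma dvd_shift: "int m dvd e - (c + int m) \<longleftrightarrow> int m dvd e - c"
proof -
  have "int m dvd e - (c + int m) + int m \<longleftrightarrow> int m dvd e - (c + int m)"
    by (rule dvd_add_triv_right_iff)
  then show ?thesis by simp
qed

lemma pat_periodic: "periodic E \<Longrightarrow> pat E (k + int m) d p q r s = pat E k d p q r s"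
proof -
  assume E: "periodic E"
  have "view E (j + int m) d = view E j d" for j d
    using E unfolding view_def periodic_def by (metis add.commute add_diff_eq)
  from this[of k] this[of "k + d"] this[of "k + 2 * d"] show ?thesis
    unfolding pat_def by (simp add: add_ac)
qed

lemma gen_periodic: "periodic E \<Longrightarrow> periodic (gen f E)"
  unfolding periodic_def[of "gen f E"] gen_def push_def pop_def dvd_shift by (simp add: pat_periodic)

text \<open>\<open>gen f E\<close> is periodic, so the sum may start at any column. The drift of a
  local pattern thus becomes a sum over the few columns that affect it, even if they wrap
  around.\<close>

lemma drift_window:
  assumes "periodic E" "n \<le> m" "\<And>c. a + int n \<le> c \<Longrightarrow> c < a
    + int m \<Longrightarrow> gen f E c = 0"
  shows "drift f E = (\<Sum>i<n. gen f E (a + int i))"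
proof -
  have "drift f E = (\<Sum>c\<in>{a..<a + int m}. gen f E c)"
    unfolding drift_def using sum_periodic[OF gen_periodic[OF assms(1)]] by simp
  also have "\<dots> = (\<Sum>c\<in>{a..<a + int n}. gen f E c)"
    using assms(2,3) by (intro sum.mono_neutral_right) auto
  also have "\<dots> = (\<Sum>i<n. gen f E (a + int i))"
    by (rule sum.reindex_bij_witness[where i = "\<lambda>i. a + int i" and j = "\<lambda>c. nat (c
      - a)"]) auto
  finally show ?thesis .
qed

lemma not_dvd_far:
  assumes "a \<le> e" "e < c" "c < a + int m"
  shows "\<not> int m dvd e - c"
  using assms zdvd_imp_le[of "int m" "c - e"] by (auto simp: dvd_diff_commute)

lemma push_pop_far:
  assumes "a \<le> e" "e + 1 < c" "c < a + int m"
  shows "push c E e = E e" "pop c E e = E e"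
  using not_dvd_far[of a e c] not_dvd_far[of a "e + 1" c] assms by (auto simp: push_def pop_def)

section \<open>Drift inequalities for the single patterns\<close>

lemma drift_exposed:
  assumes "periodic E"
  shows "drift (\<lambda>E. of_bool (exposed E k)) E \<le> 1 - 7/2 * of_bool (exposed E k)
    + (of_bool (doubled E k) + of_bool (over E (k + 1) (-1)) + of_bool (over E (k - 1) 1)) / 2"
proof -
  let ?f = "\<lambda>E. of_bool (exposed E k) :: real"
  have "drift ?f E = (\<Sum>i<3. gen ?f E (k - 1 + int i))"
    using assms m4
    by (intro drift_window) (auto simp: gen_def pat_simps push_pop_far[where a = "k - 1"])
  then have "drift ?f E = gen ?f E (k - 1) + gen ?f E k + gen ?f E (k + 1)"
    by (simp add: eval_nat_numeral add_ac)
  \<comment> \<open>An exposed column has no exposed neighbour, so a drop beside it adds a piece and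
    covers it. Conversely, one of the two signs removes the last piece that covers
    \<open>k\<close>.\<close>
  moreover have "gen ?f E (k - 1) \<le> - of_bool (exposed E k) + of_bool (over E (k - 1) 1) / 2"
    by (auto simp: gen_simps)
  \<comment> \<open>At an exposed \<open>k\<close>, one sign adds a piece and the other removes one,
    after which \<open>k\<close> is still exposed only if \<open>doubled\<close>. Otherwise the drop
    exposes \<open>k\<close>. Altogether 7/2 = 1 + 3/2 + 1.\<close>
  moreover have "gen ?f E k \<le> 1 - 3/2 * of_bool (exposed E k) + of_bool (doubled E k) / 2"
    by (auto simp: gen_simps)
  moreover have "gen ?f E (k + 1) \<le> - of_bool (exposed E k) + of_bool (over E (k + 1) (-1)) / 2"
    by (auto simp: gen_simps)
  ultimately show ?thesis by argo
qed

lemma drift_doubled: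
  assumes "periodic E"
  shows "drift (\<lambda>E. of_bool (doubled E k)) E \<le> of_bool (exposed E k) / 2
    - 3 * of_bool (doubled E k)
    + (of_bool (pat E k 1 [True,True,True] [True,True,True] [] [])
       + of_bool (pat E (k + 1) (-1) [True] [True,False,False] [True,True] [])
       + of_bool (pat E (k - 1) 1 [True] [True,False,False] [True,True] [])) / 2"
proof -
  let ?f = "\<lambda>E. of_bool (doubled E k) :: real"
  have "drift ?f E = (\<Sum>i<3. gen ?f E (k - 1 + int i))"
    using assms m4
    by (intro drift_window) (auto simp: gen_def pat_simps push_pop_far[where a = "k - 1"])
  then have "drift ?f E = gen ?f E (k - 1) + gen ?f E k + gen ?f E (k + 1)"
    by (simp add: eval_nat_numeral add_ac)
  moreover have "gen ?f E (k - 1) \<le> - of_bool (doubled E k)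
      + of_bool (pat E (k - 1) 1 [True] [True,False,False] [True,True] []) / 2"
    by (auto simp: gen_simps)
  moreover have "gen ?f E k \<le> of_bool (exposed E k) / 2 - of_bool (doubled E k)
      + of_bool (pat E k 1 [True,True,True] [True,True,True] [] []) / 2"
    by (auto simp: gen_simps)
  moreover have "gen ?f E (k + 1) \<le> - of_bool (doubled E k)
      + of_bool (pat E (k + 1) (-1) [True] [True,False,False] [True,True] []) / 2"
    by (auto simp: gen_simps)
  ultimately show ?thesis by argo
qed

text \<open>A drop in any of \<open>k - d\<close>, \<open>k\<close>, \<open>k + d\<close>,
  \<open>k + 2 * d\<close> destroys the pattern. A drop in \<open>k\<close> beside an exposed
  \<open>k + d\<close> always adds a piece and creates it. The halved terms are annihilations that
  reveal it.\<close>

lemma drift_over: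
  assumes "periodic E" "d = 1 \<or> d = -1"
  shows "drift (\<lambda>E. of_bool (over E k d)) E \<le> of_bool (exposed E (k + d))
    - 4 * of_bool (over E k d)
    + (of_bool (pat E k d [True,True] [True,True,False] [True] [])
       + of_bool (pat E (k + d) (-d) [True,True] [True,False,True] [True] [])
       + of_bool (pat E (k - d) d [True] [True,False] [True,False] [True])
       + of_bool (bridged E (k + d))) / 2"
proof -
  let ?f = "\<lambda>E. of_bool (over E k d) :: real"
  have s: "drift ?f E = gen ?f E (k - d) + gen ?f E k + gen ?f E (k + d) + gen ?f E (k + 2 * d)"
    using assms(2)
  proof
    assume d: "d = 1"
    have "drift ?f E = (\<Sum>i<4. gen ?f E (k - 1 + int i))"
      using assms(1) m4
      by (intro drift_window) (auto simp: d gen_def pat_simps push_pop_far[where a = "k - 1"])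
    then show ?thesis by (simp add: d eval_nat_numeral add_ac)
  next
    assume d: "d = -1"
    have "drift ?f E = (\<Sum>i<4. gen ?f E (k - 2 + int i))"
      using assms(1) m4
      by (intro drift_window) (auto simp: d gen_def pat_simps push_pop_far[where a = "k - 2"])
    then show ?thesis by (simp add: d eval_nat_numeral add_ac)
  qed
  have "gen ?f E k \<le> of_bool (exposed E (k + d)) - of_bool (over E k d)
      + of_bool (pat E k d [True,True] [True,True,False] [True] []) / 2"
    using assms(2) by (elim disjE; auto simp: gen_simps)
  moreover have "gen ?f E (k + d) \<le> - of_bool (over E k d)
      + of_bool (pat E (k + d) (-d) [True,True] [True,False,True] [True] []) / 2"
    using assms(2) by (elim disjE; auto simp: gen_simps)
  moreover have "gen ?f E (k - d) \<le> - of_bool (over E k d)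
      + of_bool (pat E (k - d) d [True] [True,False] [True,False] [True]) / 2"
    using assms(2) by (elim disjE; auto simp: gen_simps)
  moreover have "gen ?f E (k + 2 * d) \<le> - of_bool (over E k d) + of_bool (bridged E (k + d)) / 2"
    using assms(2) by (elim disjE; auto simp: gen_simps)
  ultimately show ?thesis using s by argo
qed

text \<open>\<open>over\<close> becomes a bridge by a drop on the other side of \<open>k\<close>,
  and any drop in \<open>k - 2\<close>, ..., \<open>k + 2\<close> destroys a bridge;
  \<open>min 5 m\<close> counts these columns modulo \<open>m\<close>.\<close>

lemma drift_bridged:
  assumes "periodic E"
  shows "drift (\<lambda>E. of_bool (bridged E k)) E
    \<le> of_bool (over E (k - 1) 1) + of_bool (over E (k + 1) (-1)) - min 5 (real m) * of_bool (bridged E k)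
      + (of_bool (pat E (k - 1) 1 [True] [False,True,False] [True,False,True] [True])
         + of_bool (pat E (k + 1) (-1) [True,True] [True,True,False] [False] [])
         + of_bool (pat E (k - 1) 1 [True,True] [True,True,False] [False] [])
         + of_bool (pat E (k + 2) (-1) [True] [True,False] [True,False] [False,True])
         + of_bool (pat E (k - 2) 1 [True] [True,False] [True,False] [False,True])) / 2"
proof -
  let ?f = "\<lambda>E. of_bool (bridged E k) :: real"
  have g0: "gen ?f E (k - 2) \<le> - of_bool (bridged E k)
      + of_bool (pat E (k - 2) 1 [True] [True,False] [True,False] [False,True]) / 2"
    by (auto simp: gen_simps)
  have g1: "gen ?f E (k - 1) \<le> of_bool (over E (k + 1) (-1)) - of_bool (bridged E k)
      + of_bool (pat E (k - 1) 1 [True,True] [True,True,False] [False] []) / 2"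
    by (auto simp: gen_simps)
  have g2: "gen ?f E k \<le> - of_bool (bridged E k)
      + of_bool (pat E (k - 1) 1 [True] [False,True,False] [True,False,True] [True]) / 2"
    by (auto simp: gen_simps)
  have g3: "gen ?f E (k + 1) \<le> of_bool (over E (k - 1) 1) - of_bool (bridged E k)
      + of_bool (pat E (k + 1) (-1) [True,True] [True,True,False] [False] []) / 2"
    by (auto simp: gen_simps)
  have g4: "gen ?f E (k + 2) \<le> - of_bool (bridged E k)
      + of_bool (pat E (k + 2) (-1) [True] [True,False] [True,False] [False,True]) / 2"
    by (auto simp: gen_simps)
  \<comment> \<open>If \<open>m = 4\<close>, the columns \<open>k - 2\<close> and
    \<open>k + 2\<close> coincide and are counted once; the term for \<open>k + 2\<close> in the
    bound is then a nonnegative surplus.\<close>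
  show ?thesis
  proof (cases "m = 4")
    case True
    have "drift ?f E = (\<Sum>i<4. gen ?f E (k - 2 + int i))"
      using assms True by (intro drift_window) auto
    then have "drift ?f E = gen ?f E (k - 2) + gen ?f E (k - 1) + gen ?f E k + gen ?f E (k + 1)"
      by (simp add: eval_nat_numeral add_ac)
    moreover have mn: "min 5 (real m) = 4" and "0 \<le> (of_bool (pat E (k
      + 2) (-1) [True] [True,False] [True,False] [False,True]) :: real)"
      using True by auto
    ultimately show ?thesis unfolding mn using g0 g1 g2 g3 by argo
  next
    case False
    then have "drift ?f E = (\<Sum>i<5. gen ?f E (k - 2 + int i))"
      using assms m4
      by (intro drift_window) (auto simp: gen_def pat_simps push_pop_far[where a = "k - 2"])
    then have "drift ?f E = gen ?f E (k - 2) + gen ?f E (k - 1) + gen ?f E k + gen ?f E (k + 1) + gen ?f E (k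
      + 2)"
      by (simp add: eval_nat_numeral add_ac)
    moreover have mn: "min 5 (real m) = 5"
      using False m4 by auto
    ultimately show ?thesis unfolding mn using g0 g1 g2 g3 g4 by argo
  qed
qed

text \<open>A lower bound, since this count enters the potential with a negative weight. A drop in
  \<open>k\<close> beside an exposed \<open>k + d\<close> creates the pair. The pair is chained only
  if the piece in \<open>k + d\<close> lay \<open>over\<close> both of its neighbours, and that
  indicator is at most the mean of the two.\<close>

lemma drift_over_not_chained:
  assumes "periodic E" "d = 1 \<or> d = -1"
  shows "of_bool (exposed E (k + d)) - (of_bool (over E (k + d) 1) + of_bool (over E (k + d) (-1))) / 2
      - min 5 (real m) * of_bool (over E k d \<and> \<not> chained E k d)
    \<le> drift (\<lambda>E. of_bool (over E k d \<and> \<not> chained E k d)) E"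
proof -
  let ?f = "\<lambda>E. of_bool (over E k d \<and> \<not> chained E k d) :: real"
  let ?g = "of_bool (exposed E (k + d)) - (of_bool (over E (k + d) 1) + of_bool (over E (k + d) (-1))) / 2"
  have ge: "gen ?f E c \<ge> (if c = k then ?g else 0) - ?f E" for c
  proof (cases "c = k")
    case True
    have "gen ?f E k \<ge> ?g - ?f E"
      using assms(2) by (elim disjE; auto simp: gen_simps)
    then show ?thesis using True by simp
  next
    case False
    then show ?thesis by (auto simp: gen_def)
  qed
  \<comment> \<open>The pair and its chaining depend on the columns from \<open>k - d\<close> to
    \<open>k + 3 * d\<close>; \<open>s\<close> is the leftmost of them.\<close>
  define s where "s = (if d = 1 then k - 1 else k - 3)"
  define n where "n = min 5 m"
  have "drift ?f E = (\<Sum>i<n. gen ?f E (s + int i))"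
  proof (cases "m = 4")
    case True
    then show ?thesis using assms(1) by (intro drift_window) (auto simp: n_def)
  next
    case False
    then show ?thesis
      using assms m4
      by (intro drift_window; elim disjE)
        (auto simp: n_def s_def gen_def pat_simps push_pop_far[where a = "k - 1"] push_pop_far[where a = "k
          - 3"])
  qed
  also have "\<dots> \<ge> (\<Sum>i<n. (if s + int i = k then ?g else 0) - ?f E)"
    by (intro sum_mono ge)
  also have "(\<Sum>i<n. (if s + int i = k then ?g else 0) - ?f E)
      = (\<Sum>i<n. if i = nat (k - s) then ?g else 0) - real n * ?f E"
    by (simp add: sum_subtractf s_def)
  also have "(\<Sum>i<n. if i = nat (k - s) then ?g else 0) = ?g"
    using m4 assms(2) by (subst sum.delta) (auto simp: s_def n_def)
  also have "real n = min 5 (real m)"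
    by (auto simp: n_def)
  finally show ?thesis .
qed

text \<open>
  Every uncovered piece is charged for the pieces and bridges that its own removal would uncover.
  The patterns are mutually exclusive enough to bound the charge by 1, and by 5/8 when the pair is
  not chained.
\<close>

lemma doubled_pairs:
  assumes "0 \<le> t" "t \<le> 1/4"
  shows "(of_bool (pat E k 1 [True,True] [True,True,False] [True] [])
      + of_bool (pat E k (-1) [True,True] [True,True,False] [True] [])) / 2
    + 5/8 * of_bool (pat E k 1 [True,True,True] [True,True,True] [] [])
    + t / 2 * (of_bool (pat E k 1 [True,True] [True,True,False] [False] [])
      + of_bool (pat E k (-1) [True,True] [True,True,False] [False] []))
    \<le> (of_bool (doubled E k) :: real)"
  using assms by (auto simp: pat_simps)

lemma over_pairs:
  assumes "0 \<le> t" "t \<le> 1/4" "d = 1 \<or> d = -1"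
  shows "(of_bool (pat E k d [True,True] [True,False,True] [True] [])
      + of_bool (pat E k d [True] [True,False] [True,False] [True])) / 2
    + 5/8 * of_bool (pat E k d [True] [True,False,False] [True,True] [])
    + t / 2 * (of_bool (pat E (k - 1) 1 [True] [False,True,False] [True,False,True] [True]) / 2
      + of_bool (pat E k d [True] [True,False] [True,False] [False,True]))
    \<le> of_bool (over E k d) - 3/8 * (of_bool (over E k d \<and> \<not> chained E k d) :: real)"
proof -
  let ?P = "pat E k d [True,True] [True,False,True] [True] []"
  let ?F = "pat E k d [True] [True,False] [True,False] [True]"
  let ?S = "pat E k d [True] [True,False,False] [True,True] []"
  let ?C = "pat E (k - 1) 1 [True] [False,True,False] [True,False,True] [True]"
  let ?G = "pat E k d [True] [True,False] [True,False] [False,True]"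
  have imp: "?P \<Longrightarrow> over E k d" "?F \<Longrightarrow> over E k d" "?S \<Longrightarrow> over E k d"
    "?C \<Longrightarrow> over E k d" "?G \<Longrightarrow> over E k d"
    using assms(3) by - (elim disjE; auto simp: pat_simps algebra_simps)+
  have exc: "?P \<Longrightarrow> \<not> ?S \<and> \<not> ?C" "?F \<Longrightarrow> \<not> ?S
    \<and> \<not> ?G" "?C \<Longrightarrow> \<not> ?S" "?G \<Longrightarrow> \<not> ?S"
    using assms(3) by - (elim disjE; auto simp: pat_simps algebra_simps)+
  have ch: "?P \<Longrightarrow> ?F \<Longrightarrow> chained E k d"
    by (auto simp: pat_simps)
  \<comment> \<open>\<open>P\<close> and \<open>F\<close> count 1/2 each and occur together only
    when chained. \<open>S\<close> excludes all others, \<open>P\<close> excludes \<open>C\<close>,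
    and \<open>F\<close> excludes \<open>G\<close>; so without chaining the largest charge is 1/2 +
    1/8 = 5/8. \<open>C\<close> is halved because its configuration is charged in both
    directions.\<close>
  have bool: "(of_bool P + of_bool F) / 2 + 5/8 * of_bool S + t / 2 * (of_bool C / 2 + of_bool G)
      \<le> of_bool X - 3/8 * (of_bool (X \<and> \<not> Z) :: real)"
    if "P \<or> F \<or> S \<or> C \<or> G \<longrightarrow> X" "P \<longrightarrow> \<not> S
      \<and> \<not> C" "F \<longrightarrow> \<not> S \<and> \<not> G"
       "C \<longrightarrow> \<not> S" "G \<longrightarrow> \<not> S" "P
         \<and> F \<longrightarrow> Z" for P F S C G X Z
    using that assms(1,2) by (cases P; cases F; cases S; cases C; cases G; cases X; cases Z; simp)
  show ?thesis
    using imp exc ch by (intro bool) blast+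
qed

section \<open>Summation over all columns and the potential\<close>

lemma gen_linear:
  "gen (\<lambda>E. f E + g E) E c = gen f E c + gen g E c"
  "gen (\<lambda>E. f E - g E) E c = gen f E c - gen g E c"
  "gen (\<lambda>E. a * f E) E c = a * gen f E c"
  by (auto simp: gen_def field_simps)

lemma drift_linear:
  "drift (\<lambda>E. f E + g E) E = drift f E + drift g E"
  "drift (\<lambda>E. f E - g E) E = drift f E - drift g E"
  "drift (\<lambda>E. a * f E) E = a * drift f E"
  "drift (\<lambda>E. \<Sum>k\<in>A. h k E) E = (\<Sum>k\<in>A. drift (h k) E)"
proof -
  have "gen (\<lambda>E. \<Sum>k\<in>A. h k E) E c = (\<Sum>k\<in>A. gen (h k) E c)" for c
    by (induction A rule: infinite_finite_induct) (simp_all add: gen_linear, simp_all add: gen_def)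
  then show "drift (\<lambda>E. \<Sum>k\<in>A. h k E) E = (\<Sum>k\<in>A. drift (h k) E)"
    unfolding drift_def using sum.swap by simp
qed (simp_all add: drift_def gen_linear sum.distrib sum_subtractf sum_distrib_left)

definition total :: "(int \<Rightarrow> bool) \<Rightarrow> real" where
  "total P = (\<Sum>k\<in>{0..<int m}. of_bool (P k))"

lemma total_shift:
  assumes "periodic E"
  shows "(\<Sum>k\<in>{0..<int m}. of_bool (pat E (k + a) d p q r s)) = total (\<lambda>k. pat E k d p q r s)"
    and "(\<Sum>k\<in>{0..<int m}. of_bool (pat E (k - a) d p q r s)) = total (\<lambda>k. pat E k d p q r s)"
    and "(\<Sum>k\<in>{0..<int m}. of_bool (pat E k d p q r s)) = total (\<lambda>k. pat E k d p q r s)"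
proof -
  have "periodic (\<lambda>k. of_bool (pat E k d p q r s) :: real)"
    unfolding periodic_def using assms by (simp add: pat_periodic)
  note sum_periodic_shift[OF this, of a] sum_periodic_shift[OF this, of "- a"]
  then show
    "(\<Sum>k\<in>{0..<int m}. of_bool (pat E (k + a) d p q r s)) = total (\<lambda>k. pat E k d p q r s)"
    "(\<Sum>k\<in>{0..<int m}. of_bool (pat E (k - a) d p q r s)) = total (\<lambda>k. pat E k d p q r s)"
    "(\<Sum>k\<in>{0..<int m}. of_bool (pat E k d p q r s)) = total (\<lambda>k. pat E k d p q r s)"
    by (simp_all add: total_def)
qed

definition roofsize :: "(int \<Rightarrow> bool list) \<Rightarrow> real" where
  "roofsize E = total (exposed E)"

text \<open>
  The weights solve the linear program given by the drift bounds above: they cancel the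
  contributions of \<open>over\<close>, \<open>bridged\<close> and \<open>chained\<close>, and leave a nonpositive coefficient for
  \<open>doubled\<close>. The number \<open>c\<close> of columns that can destroy a bridge is 4 if \<open>m = 4\<close>, since \<open>k - 2\<close> and
  \<open>k + 2\<close> then coincide, and 5 otherwise.
\<close>

definition potential :: "(int \<Rightarrow> bool list) \<Rightarrow> real" where
  "potential E = (let c = min 5 (real m) in
     \<Sum>k\<in>{0..<int m}. of_bool (exposed E k) + 1 / (2 * (3 - 11 / (8 * c))) *
       (of_bool (over E k 1) + of_bool (over E k (-1)) + 5/4 * of_bool (doubled E k)
        + 1 / c * of_bool (bridged E k)
        - 3 / (8 * c) * (of_bool (over E k 1 \<and> \<not> chained E k 1) + of_bool (over E k (-1)
          \<and> \<not> chained E k (-1)))))"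

lemma drift_potential:
  assumes E: "periodic E"
  shows "drift potential E \<le> real m - 3.041 * roofsize E"
proof -
  let ?A = "{0..<int m}"
  define c where "c = min 5 (real m)"
  define r where "r = total (exposed E)"
  define s where "s = total (doubled E)"
  define x where "x d = total (\<lambda>k. over E k d)" for d
  define b where "b = total (bridged E)"
  define n where "n d = total (\<lambda>k. over E k d \<and> \<not> chained E k d)" for d
  define ss where "ss = total (\<lambda>k. pat E k 1 [True,True,True] [True,True,True] [] [])"
  define sx where "sx d = total (\<lambda>k. pat E k d [True,True] [True,True,False] [True] [])" for d
  define sb where "sb d = total (\<lambda>k. pat E k d [True,True] [True,True,False] [False] [])" for d
  define xs where "xs d = total (\<lambda>k. pat E k d [True] [True,False,False] [True,True] [])" for d
  define xp where "xp d = total (\<lambda>k. pat E k d [True,True] [True,False,True] [True] [])" for d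
  define xf where "xf d = total (\<lambda>k. pat E k d [True] [True,False] [True,False] [True])" for d
  define xb where "xb d = total (\<lambda>k. pat E k d [True] [True,False] [True,False] [False,True])" for d
  define xx where "xx = total (\<lambda>k. pat E k 1 [True] [False,True,False] [True,False,True] [True])"
  have b_alt: "b = total (\<lambda>k. pat E k 1 [True] [True,False] [False,True] [True])"
    unfolding b_def using total_shift(2)[OF E, of 1] by (simp add: total_def)
  note tot = sum.distrib sum_subtractf sum_negf total_shift[OF E] sum_divide_distrib[symmetric] sum_distrib_left[symmetric]
  note defs = r_def s_def x_def b_alt n_def ss_def sx_def sb_def xs_def xp_def xf_def xb_def xx_def
  have R: "(\<Sum>k\<in>?A. drift (\<lambda>E. of_bool (exposed E k)) E) \<le> real m - 7/2 * r + (s + x (-1)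
    + x 1) / 2"
    by (rule order_trans[OF sum_mono], rule drift_exposed[OF E], unfold tot defs, simp)
  have S: "(\<Sum>k\<in>?A. drift (\<lambda>E. of_bool (doubled E k)) E) \<le> r / 2 - 3 * s + (ss + xs (-1)
    + xs 1) / 2"
    by (rule order_trans[OF sum_mono], rule drift_doubled[OF E], unfold tot defs, simp)
  have X: "(\<Sum>k\<in>?A. drift (\<lambda>E. of_bool (over E k d)) E) \<le> r - 4 * x d + (sx d + xp (-d)
    + xf d + b) / 2"
    if "d = 1 \<or> d = -1" for d
    by (rule order_trans[OF sum_mono], rule drift_over[OF E that], unfold add_diff_eq[symmetric] tot defs, simp)
  have B: "(\<Sum>k\<in>?A. drift (\<lambda>E. of_bool (bridged E k)) E)
      \<le> x 1 + x (-1) - c * b + (xx + sb (-1) + sb 1 + xb (-1) + xb 1) / 2"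
    by (rule order_trans[OF sum_mono], rule drift_bridged[OF E, folded c_def], unfold tot defs, simp)
  have N: "r - (x 1 + x (-1)) / 2 - c * n d \<le> (\<Sum>k\<in>?A. drift (\<lambda>E. of_bool (over E k d
    \<and> \<not> chained E k d)) E)"
    if "d = 1 \<or> d = -1" for d
    by (rule order_trans[rotated, OF sum_mono], rule drift_over_not_chained[OF E that, folded c_def], unfold tot defs, simp add: total_def)
  have c: "c = 4 \<or> c = 5"
    using m4 by (auto simp: c_def)
  have t: "0 \<le> 1 / c" "1 / c \<le> 1/4" using c by auto
  have SP: "(sx 1 + sx (-1)) / 2 + 5/8 * ss + 1 / c / 2 * (sb 1 + sb (-1)) \<le> s"
    using sum_mono[where K = ?A and g = "\<lambda>k. of_bool (doubled E k)", OF doubled_pairs[OF t, of E]]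
      unfolding tot defs by simp
  have XP: "(xp d + xf d) / 2 + 5/8 * xs d + 1 / c / 2 * (xx / 2 + xb d) \<le> x d - 3/8 * n d"
    if "d = 1 \<or> d = -1" for d
    using sum_mono[where K = ?A and g = "\<lambda>k. of_bool (over E k d) - 3/8 * of_bool (over E k d
      \<and> \<not> chained E k d)", OF over_pairs[OF t that, of E]] unfolding tot defs
        by (simp add: total_def)
  have nonneg: "0 \<le> r" "0 \<le> s" "0 \<le> x 1" "0 \<le> x (-1)"
    unfolding r_def s_def x_def total_def by (auto intro: sum_nonneg)
  define dr where "dr = (\<Sum>k\<in>?A. drift (\<lambda>E. of_bool (exposed E k)) E)"
  define ds where "ds = (\<Sum>k\<in>?A. drift (\<lambda>E. of_bool (doubled E k)) E)"
  define dx where "dx d = (\<Sum>k\<in>?A. drift (\<lambda>E. of_bool (over E k d)) E)" for d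
  define db where "db = (\<Sum>k\<in>?A. drift (\<lambda>E. of_bool (bridged E k)) E)"
  define dn where "dn d = (\<Sum>k\<in>?A. drift (\<lambda>E. of_bool (over E k d
    \<and> \<not> chained E k d)) E)" for d
  have "drift potential E = dr + 1 / (2 * (3 - 11 / (8 * c))) *
       (dx 1 + dx (-1) + 5/4 * ds + 1 / c * db - 3 / (8 * c) * (dn 1 + dn (-1)))"
    unfolding potential_def[abs_def] Let_def c_def[symmetric] drift_linear sum.distrib sum_subtractf
       sum_distrib_left[symmetric] dr_def ds_def dx_def db_def dn_def by simp
  also have "\<dots> \<le> real m - 3.041 * r"
  proof -
    define T where "T = dx 1 + dx (-1) + 5/4 * ds + 1 / c * db - 3 / (8 * c) * (dn 1 + dn (-1))"
    have X2: "dx 1 + dx (-1) \<le> 2 * r - 4 * (x 1 + x (-1)) + (sx 1 + sx (-1) + (xp 1 + xf 1) + (xp (-1)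
      + xf (-1))) / 2 + b"
      using X[of 1] X[of "-1"] unfolding dx_def[symmetric] minus_minus by argo
    have N2: "2 * r - (x 1 + x (-1)) - c * (n 1 + n (-1)) \<le> dn 1 + dn (-1)"
      using N[of 1] N[of "-1"] unfolding dn_def[symmetric] distrib_left by argo
    have S2: "5/4 * ds \<le> 5/8 * r - 15/4 * s + 5/8 * (ss + xs (-1) + xs 1)"
      using S unfolding ds_def[symmetric] by argo
    have B2: "1 / c * db \<le> 1 / c * (x 1 + x (-1)) - b + 1 / c / 2 * (xx + (sb 1 + sb (-1)) + xb 1
      + xb (-1))"
    proof -
      have "1 / c * db \<le> 1 / c * (x 1 + x (-1) - c * b + (xx + sb (-1) + sb 1 + xb (-1) + xb 1) / 2)"
        using B t(1) unfolding db_def[symmetric] by (intro mult_left_mono)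
      also have "\<dots> = 1 / c * (x 1 + x (-1)) - b + 1 / c / 2 * (xx + (sb 1 + sb (-1)) + xb 1 + xb (-1))"
        using c by (auto simp: field_simps)
      finally show ?thesis .
    qed
    have N3: "3 / (8 * c) * (2 * r - (x 1 + x (-1))) - 3/8 * (n 1 + n (-1)) \<le> 3 / (8 * c) * (dn 1
      + dn (-1))"
    proof -
      have "3 / (8 * c) * (2 * r - (x 1 + x (-1)) - c * (n 1 + n (-1))) \<le> 3 / (8 * c) * (dn 1 + dn (-1))"
        using N2 c by (intro mult_left_mono) auto
      then show ?thesis using c by (auto simp: field_simps)
    qed
    have XP2: "((xp 1 + xf 1) + (xp (-1) + xf (-1))) / 2 + 5/8 * (xs 1 + xs (-1)) + 1 / c / 2 * (xx + xb 1
      + xb (-1))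
        \<le> x 1 + x (-1) - 3/8 * (n 1 + n (-1))"
      using XP[of 1] XP[of "-1"] unfolding distrib_left by argo
    \<comment> \<open>\<open>b\<close> cancels because a bridge has weight 1/c and is destroyed at
      rate \<open>c\<close>. \<open>SP\<close> and \<open>XP2\<close> absorb the patterns revealed
      by annihilations, and their gain of 3/8 per unchained pair cancels the \<open>n\<close> terms
      of \<open>N3\<close>.\<close>
    have T: "T \<le> (21/8 - 2 * (3 / (8 * c))) * r - (3 - 1 / c - 3 / (8 * c)) * (x 1 + x (-1)) - 11/4 * s"
      using X2 S2 B2 N3 SP XP2 unfolding T_def distrib_left left_diff_distrib right_diff_distrib by argo
    have dr: "dr \<le> real m - 7/2 * r + (s + x (-1) + x 1) / 2"
      using R unfolding dr_def .
    \<comment> \<open>The factor turns the \<open>x\<close> terms of \<open>T\<close> into exactly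
      the negative of those in \<open>dr\<close>. The worse case is \<open>c = 4\<close>, with
      coefficient 7/2 - 39/85 = 3.0411...; \<open>c = 5\<close> gives 7/2 - 99/218 =
      3.0458....\<close>
    have "dr + 1 / (2 * (3 - 11 / (8 * c))) * T \<le> real m - 3041/1000 * r"
      using c
    proof
      assume c: "c = 4"
      have "T \<le> 39/16 * r - 85/32 * (x 1 + x (-1)) - 11/4 * s"
        using T by (simp add: c)
      moreover have al: "1 / (2 * (3 - 11 / (8 * c))) = 16/85"
        by (simp add: c)
      ultimately show ?thesis unfolding al using dr nonneg by argo
    next
      assume c: "c = 5"
      have "T \<le> 99/40 * r - 109/40 * (x 1 + x (-1)) - 11/4 * s"
        using T by (simp add: c)
      moreover have al: "1 / (2 * (3 - 11 / (8 * c))) = 20/109"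
        by (simp add: c)
      ultimately show ?thesis unfolding al using dr nonneg by argo
    qed
    then show ?thesis unfolding T_def by simp
  qed
  finally show ?thesis by (simp add: r_def roofsize_def)
qed

end

section \<open>Existence of the limit\<close>

definition shape :: "(int \<Rightarrow> (bool \<times> bool) list) \<Rightarrow> int
  \<Rightarrow> bool list" where
  "shape F = (\<lambda>e. map fst (F e))"

text \<open>Every column is recorded twice, in the words of the edges on its two sides; the two
  records must agree.\<close>

definition column_consistent :: "(int \<Rightarrow> (bool \<times> bool) list) \<Rightarrow> bool" where
  "column_consistent F \<longleftrightarrow>
    (\<forall>c. map snd (filter fst (F c)) = map snd (filter (\<lambda>x. \<not> fst x) (F (c - 1))))"

fun cancel :: "bool \<times> bool \<Rightarrow> (bool \<times> bool) list
  \<Rightarrow> (bool \<times> bool) list" where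
  "cancel x [] = [x]"
| "cancel x (y # r) = (if fst y = fst x \<and> snd y \<noteq> snd x then r else x # y # r)"

text \<open>The image of the walk in the free group on the two generators of an edge, as a reduced
  word with the latest letter first.\<close>

definition free_reduct :: "(bool \<times> bool) list \<Rightarrow> (bool \<times> bool) list" where
  "free_reduct w = foldr cancel w []"

fun reduced :: "(bool \<times> bool) list \<Rightarrow> bool" where
  "reduced (x # y # r) \<longleftrightarrow> \<not> (fst y = fst x \<and> snd y \<noteq> snd x)
    \<and> reduced (y # r)"
| "reduced _ \<longleftrightarrow> True"

lemma reduced_tl: "reduced (x # r) \<Longrightarrow> reduced r"
  by (cases r) auto

lemma reduced_cancel: "reduced r \<Longrightarrow> reduced (cancel x r)"
  by (cases r) (auto dest: reduced_tl)

lemma reduced_free_reduct: "reduced (free_reduct w)"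
  unfolding free_reduct_def by (induction w) (auto intro: reduced_cancel)

text \<open>The two letters are inverse to each other. If the first one cancels the head of
  \<open>r\<close>, reducedness prevents the second from cancelling the next letter, so the head is
  restored.\<close>

lemma cancel_cancel:
  assumes "reduced r" "s \<noteq> t"
  shows "cancel (b, s) (cancel (b, t) r) = r"
  using assms by (cases r rule: reduced.cases) auto

text \<open>At a nonempty word, one letter doubles the weight and three halve it: 2 + 3/2 = 7/2. At
  the empty word all four halve it.\<close>

lemma cancel_weight:
  "(\<Sum>b\<in>UNIV. \<Sum>s\<in>UNIV. (1/2::real) ^ length (cancel (b, s) r)) \<le> 7/2 * (1/2) ^ length r"
  by (cases r) (auto simp: UNIV_bool)

context four_columns
begin

definition spush :: "int \<Rightarrow> bool \<Rightarrow> (int \<Rightarrow> (bool \<times> bool) list)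
  \<Rightarrow> int \<Rightarrow> (bool \<times> bool) list" where
  "spush c s F = (\<lambda>e. if int m dvd e - c then (True, s) # F e
                   else if int m dvd e + 1 - c then (False, s) # F e else F e)"

definition sdrop :: "(int \<Rightarrow> (bool \<times> bool) list) \<Rightarrow> int \<times> bool
  \<Rightarrow> int \<Rightarrow> (bool \<times> bool) list" where
  "sdrop F = (\<lambda>(c, s). if exposed (shape F) c
    \<and> snd (hd (F c)) \<noteq> s then pop c F else spush c s F)"

definition good :: "(int \<Rightarrow> (bool \<times> bool) list) \<Rightarrow> bool" where
  "good F \<longleftrightarrow> periodic F \<and> column_consistent F"

text \<open>
  Multiplication from the left by a generator, in the case that it does not cancel: the new piece is
  put underneath the whole heap.
\<close>

definition bottom :: "int \<times> bool \<Rightarrow> (int \<Rightarrow> (bool \<times> bool) list)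
  \<Rightarrow> int \<Rightarrow> (bool \<times> bool) list" where
  "bottom = (\<lambda>(c, s) F e. if int m dvd e - c then F e @ [(True, s)]
                   else if int m dvd e + 1 - c then F e @ [(False, s)] else F e)"

text \<open>The transition operator of the walk; its \<open>n\<close>-th power gives the expectation
  after \<open>n\<close> drops from \<open>F\<close>.\<close>

definition step :: "((int \<Rightarrow> (bool \<times> bool) list) \<Rightarrow> real) \<Rightarrow> (int
  \<Rightarrow> (bool \<times> bool) list) \<Rightarrow> real" where
  "step f F = (\<Sum>c\<in>{0..<int m}. \<Sum>s\<in>UNIV. f (sdrop F (c, s))) / (2 * real m)"

section \<open>Signed drops and pieces put underneath\<close>

lemma exposed_shape:
  "exposed (shape F) c \<longleftrightarrow> F c \<noteq> [] \<and> fst (hd (F c)) \<and> F (c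
    - 1) \<noteq> [] \<and> \<not> fst (hd (F (c - 1)))"
  by (auto simp: pat_simps shape_def hd_map)

lemma shape_sdrop:
  "shape (spush c s F) = push c (shape F)" "shape (pop c F) = pop c (shape F)"
  by (auto simp: shape_def spush_def push_def pop_def map_tl)

lemma periodic_cong:
  assumes "periodic g" "int m dvd a - b"
  shows "g a = g b"
proof -
  have "g (x + int m * y) = g x" for x y
  proof (induction y rule: int_induct[where k = 0])
    case (step1 i)
    then show ?case using assms(1) unfolding periodic_def
      by (metis add.assoc distrib_left mult.right_neutral)
  next
    case (step2 i)
    have "g (x + int m * (i - 1) + int m) = g (x + int m * (i - 1))"
      using assms(1) unfolding periodic_def by blast
    then show ?case using step2 by (simp add: algebra_simps)
  qed simp
  moreover obtain y where "a = b + int m * y"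
    using assms(2) by (metis dvdE add.commute diff_add_cancel)
  ultimately show ?thesis by simp
qed

lemma dvd_plus_m: "int m dvd e + int m - c \<longleftrightarrow> int m dvd e - c"
  "int m dvd e + int m + 1 - c \<longleftrightarrow> int m dvd e + 1 - c"
proof -
  show "int m dvd e + int m - c \<longleftrightarrow> int m dvd e - c" for e
    using dvd_add_triv_right_iff[of "int m" "e - c"] by (simp add: algebra_simps)
  from this[of "e + 1"] show "int m dvd e + int m + 1 - c \<longleftrightarrow> int m dvd e + 1 - c"
    by (simp add: algebra_simps)
qed

lemma periodic_sdrop: "periodic F \<Longrightarrow> periodic (sdrop F x)"
  unfolding periodic_def sdrop_def pop_def spush_def by (cases x) (simp add: dvd_plus_m)

text \<open>Exposure of \<open>c\<close> means that both edge words at \<open>c\<close> start with a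
  letter of column \<open>c\<close>, so an annihilation shortens the two records of this column and
  no other.\<close>

lemma consistent_sdrop:
  assumes "periodic F" "column_consistent F"
  shows "column_consistent (sdrop F x)"
proof (cases x)
  case (Pair c s)
  have *: "map snd (filter fst (sdrop F (c, s) k))
    = map snd (filter (\<lambda>x. \<not> fst x) (sdrop F (c, s) (k - 1)))" for k
  proof -
    have con: "map snd (filter fst (F k)) = map snd (filter (\<lambda>x. \<not> fst x) (F (k - 1)))"
      using assms(2) unfolding column_consistent_def by blast
    have e: "exposed (shape F) c \<Longrightarrow> int m dvd e - c \<Longrightarrow> \<exists>s l. F e
      = (True, s) # l" for e
      using periodic_cong[OF assms(1), of e c] unfolding exposed_shape by (cases "F c") auto
    have e': "exposed (shape F) c \<Longrightarrow> int m dvd e + 1 - c \<Longrightarrow> \<exists>s l. F e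
      = (False, s) # l" for e
      using periodic_cong[OF assms(1), of e "c - 1"] unfolding exposed_shape by (cases "F (c
        - 1)") (auto simp: algebra_simps)
    have d: "\<not> (int m dvd k - c \<and> int m dvd k + 1 - c)" "\<not> (int m dvd k - 1 - c
      \<and> int m dvd k - c)"
      using dvd_diff[of "int m" "k + 1 - c" "k - c"] dvd_diff[of "int m" "k - c" "k - 1 - c"] dvd_small
        by auto
    show ?thesis
    proof (cases "exposed (shape F) c \<and> snd (hd (F c)) \<noteq> s")
      case True
      then show ?thesis using con d e[of k] e'[of k] e[of "k - 1"] e'[of "k - 1"]
        by (auto simp: sdrop_def pop_def)
    next
      case False
      then show ?thesis using con d by (auto simp: sdrop_def spush_def)
    qed
  qed
  then show ?thesis unfolding Pair column_consistent_def by blast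
qed

lemma good_sdrop: "good F \<Longrightarrow> good (sdrop F x)"
  unfolding good_def by (simp add: periodic_sdrop consistent_sdrop)

lemma good_pop_sign:
  assumes "good F" "exposed (shape F) c"
  shows "snd (hd (F (c - 1))) = snd (hd (F c))"
proof -
  have "map snd (filter fst (F c)) = map snd (filter (\<lambda>x. \<not> fst x) (F (c - 1)))"
    using assms(1) unfolding good_def column_consistent_def by blast
  then show ?thesis
    using assms(2) unfolding exposed_shape by (cases "F c"; cases "F (c - 1)") auto
qed

text \<open>An appended letter becomes the head only of an empty word. If just one of the two words
  at \<open>k\<close> is empty, consistency prevents the other from starting with a letter of column
  \<open>k\<close>, so \<open>k\<close> is exposed neither before nor after.\<close>

lemma bottom_not_exposed:
  assumes "good B" "\<not> (int m dvd k - c \<and> B k = [] \<and> B (k - 1) = [])"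
  shows "exposed (shape (bottom (c, s) B)) k \<longleftrightarrow> exposed (shape B) k"
proof -
  have con: "map snd (filter fst (B k)) = map snd (filter (\<lambda>x. \<not> fst x) (B (k - 1)))"
    using assms(1) unfolding good_def column_consistent_def by blast
  have d: "\<not> (int m dvd k - c \<and> int m dvd k + 1 - c)" "\<not> (int m dvd k - 1 - c
    \<and> int m dvd k - c)"
    using dvd_diff[of "int m" "k + 1 - c" "k - c"] dvd_diff[of "int m" "k - c" "k - 1 - c"] dvd_small by auto
  show ?thesis
    using con d assms(2) unfolding exposed_shape bottom_def
    by (cases "B k"; cases "B (k - 1)") (auto split: if_splits)
qed

text \<open>Left and right multiplication commute. The only exception is a drop that annihilates the
  bottom piece itself; then the other heap receives the dropped piece as its bottom piece, and the
  two heaps exchange roles.\<close>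

lemma sdrop_bottom:
  assumes "good B"
  shows "sdrop (bottom x B) y = bottom x (sdrop B y) \<or>
    sdrop B y = bottom y (sdrop (bottom x B) y)"
proof -
  obtain c s where x: "x = (c, s)" by (cases x)
  obtain k t where y: "y = (k, t)" by (cases y)
  have per: "periodic B" using assms by (simp add: good_def)
  show ?thesis
  proof (cases "int m dvd k - c \<and> B k = [] \<and> B (k - 1) = []")
    case True
    have eq: "int m dvd e - c \<longleftrightarrow> int m dvd e - k" for e
      using True dvd_add_right_iff[of "int m" "k - c" "e - k"] by simp
    have nil: "B e = []" if "int m dvd e - k \<or> int m dvd e + 1 - k" for e
      using that True periodic_cong[OF per, of e k] periodic_cong[OF per, of e "k - 1"]
        by (auto simp: algebra_simps)
    have nexp: "\<not> exposed (shape B) k" using True unfolding exposed_shape by simp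
    have bot: "bottom (c, s) B = spush k s B"
      unfolding bottom_def spush_def using eq eq[of "_ + 1"] nil by (auto simp: fun_eq_iff)
    show ?thesis
    proof (cases "s = t")
      case True
      have "snd (hd (spush k s B k)) = s" by (simp add: spush_def)
      then have "sdrop (bottom x B) y = spush k t (spush k s B)"
        unfolding x y bot sdrop_def using True by simp
      moreover have "bottom x (sdrop B y) = spush k t (spush k s B)"
        unfolding x y sdrop_def bottom_def spush_def using nexp eq eq[of "_ + 1"] nil
          by (auto simp: fun_eq_iff spush_def)
      ultimately show ?thesis by simp
    next
      case False
      have "exposed (shape (spush k s B)) k"
        unfolding exposed_shape using dvd_small by (auto simp: spush_def)
      moreover have "snd (hd (spush k s B k)) = s" by (simp add: spush_def)
      ultimately have "sdrop (bottom x B) y = pop k (spush k s B)"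
        unfolding x y bot sdrop_def using False by simp
      also have "\<dots> = B"
        unfolding pop_def spush_def by auto
      finally have "sdrop (bottom x B) y = B" .
      moreover have "sdrop B y = bottom y B"
        unfolding y sdrop_def bottom_def spush_def using nexp nil by (auto simp: fun_eq_iff)
      ultimately show ?thesis by simp
    qed
  next
    case False
    note ex = bottom_not_exposed[OF assms False, of s]
    show ?thesis
    proof (cases "exposed (shape B) k")
      case True
      then have ne: "B k \<noteq> []" "B (k - 1) \<noteq> []" unfolding exposed_shape by auto
      then have ne': "B e \<noteq> []" if "int m dvd e - k \<or> int m dvd e + 1 - k" for e
        using that periodic_cong[OF per, of e k] periodic_cong[OF per, of e "k - 1"]
          by (auto simp: algebra_simps)
      have "hd (bottom (c, s) B k) = hd (B k)"
        using ne by (simp add: bottom_def)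
      moreover have "pop k (bottom (c, s) B) = bottom (c, s) (pop k B)"
        using ne' by (auto simp: fun_eq_iff pop_def bottom_def)
      moreover have "spush k t (bottom (c, s) B) = bottom (c, s) (spush k t B)"
        by (auto simp: fun_eq_iff spush_def bottom_def)
      ultimately show ?thesis
        unfolding x y sdrop_def using ex by simp
    next
      case False
      have "spush k t (bottom (c, s) B) = bottom (c, s) (spush k t B)"
        by (auto simp: fun_eq_iff spush_def bottom_def)
      then show ?thesis
        unfolding x y sdrop_def using ex False by simp
    qed
  qed
qed

definition near :: "(int \<Rightarrow> (bool \<times> bool) list) \<Rightarrow> (int
  \<Rightarrow> (bool \<times> bool) list) \<Rightarrow> bool" where
  "near A B \<longleftrightarrow> good A \<and> good B \<and> (\<exists>x. A = bottom x B \<or> B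
    = bottom x A)"

lemma near_sdrop: "near A B \<Longrightarrow> near (sdrop A y) (sdrop B y)"
  unfolding near_def using sdrop_bottom good_sdrop by metis

text \<open>Dominates the number of empty edge words, and unlike that number it contracts in mean
  under every drop.\<close>

definition weight :: "(int \<Rightarrow> (bool \<times> bool) list) \<Rightarrow> real" where
  "weight F = (\<Sum>k\<in>{0..<int m}. (1/2) ^ length (free_reduct (F k)))"

definition roof_count :: "(int \<Rightarrow> (bool \<times> bool) list) \<Rightarrow> real" where
  "roof_count F = roofsize (shape F)"

text \<open>The exposure of \<open>k\<close> can differ only if the word of edge \<open>k\<close> is
  empty in the heap without the extra piece, and such an edge has weight 1.\<close>

lemma roof_count_near:
  assumes "near A B"
  shows "\<bar>roof_count A - roof_count B\<bar> \<le> weight A + weight B"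
proof -
  have bot: "\<bar>of_bool (exposed (shape (bottom x B)) k) - of_bool (exposed (shape B) k)\<bar>
      \<le> (1/2 :: real) ^ length (free_reduct (B k))" if "good B" for x B k
  proof (cases "B k = []")
    case True
    then show ?thesis by (simp add: free_reduct_def)
  next
    case False
    obtain c s where x: "x = (c, s)" by (cases x)
    show ?thesis unfolding x using bottom_not_exposed[OF that, of k c s] False by simp
  qed
  have "\<bar>of_bool (exposed (shape A) k) - of_bool (exposed (shape B) k)\<bar>
      \<le> (1/2 :: real) ^ length (free_reduct (A k)) + (1/2) ^ length (free_reduct (B k))" for k
  proof -
    have nn: "0 \<le> (1/2 :: real) ^ length (free_reduct (A k))" "0
      \<le> (1/2 :: real) ^ length (free_reduct (B k))"
      by simp_all
    from assms obtain x where "good A" "good B" "A = bottom x B \<or> B = bottom x A"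
      unfolding near_def by blast
    then show ?thesis using bot[of A x k] bot[of B x k] nn by (elim disjE) (simp_all add: abs_minus_commute)
  qed
  then have "(\<Sum>k\<in>{0..<int m}. \<bar>of_bool (exposed (shape A) k)
    - of_bool (exposed (shape B) k)\<bar>)
     \<le> weight A + weight B"
    unfolding weight_def sum.distrib[symmetric] by (intro sum_mono)
  moreover have "\<bar>roof_count A - roof_count B\<bar>
     \<le> (\<Sum>k\<in>{0..<int m}. \<bar>of_bool (exposed (shape A) k)
       - of_bool (exposed (shape B) k)\<bar>)"
    unfolding roof_count_def roofsize_def total_def sum_subtractf[symmetric] by (rule sum_abs)
  ultimately show ?thesis by linarith
qed

text \<open>An annihilation, too, acts as multiplication by the dropped letter, by
  \<open>cancel_cancel\<close>. So the free reduct of an edge evolves as a walk of its own, whatever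
  the other columns do.\<close>

lemma free_reduct_sdrop:
  assumes "good F"
  shows "free_reduct (sdrop F (c, s) e) =
    (if int m dvd e - c then cancel (True, s) (free_reduct (F e))
     else if int m dvd e + 1 - c then cancel (False, s) (free_reduct (F e)) else free_reduct (F e))"
proof (cases "exposed (shape F) c \<and> snd (hd (F c)) \<noteq> s")
  case False
  then show ?thesis by (auto simp: sdrop_def spush_def free_reduct_def)
next
  case True
  have per: "periodic F" using assms by (simp add: good_def)
  have *: "free_reduct l = cancel (b, s) (free_reduct ((b, t) # l))" if "s \<noteq> t" for b t l
    using cancel_cancel[OF reduced_free_reduct that, of b l] by (simp add: free_reduct_def)
  have 1: "F c = (True, snd (hd (F c))) # tl (F c)"
    using True unfolding exposed_shape by (cases "F c") auto
  have 2: "F (c - 1) = (False, snd (hd (F c))) # tl (F (c - 1))"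
    using True good_pop_sign[OF assms, of c] unfolding exposed_shape by (cases "F (c - 1)") auto
  have "int m dvd e - c \<Longrightarrow> F e = F c" "int m dvd e + 1 - c \<Longrightarrow> F e = F (c - 1)"
    using periodic_cong[OF per, of e c] periodic_cong[OF per, of e "c - 1"] by (auto simp: algebra_simps)
  then show ?thesis
    using True *[of "snd (hd (F c))" "tl (F c)" True] *[of "snd (hd (F c))" "tl (F (c - 1))" False] 1 2
    by (auto simp: sdrop_def pop_def)
qed


section \<open>Averages over drops and exponential decay\<close>

lemma step_mono:
  assumes "good F" "\<And>F. good F \<Longrightarrow> f F \<le> g F"
  shows "step f F \<le> step g F"
  unfolding step_def using assms good_sdrop by (intro divide_right_mono sum_mono) auto

lemma step_power_Suc:
  "(step ^^ Suc n) f F = (\<Sum>c\<in>{0..<int m}. \<Sum>s\<in>UNIV. (step ^^ n) f (sdrop F (c, s))) / (2 * real m)"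
  by (simp only: funpow.simps o_apply step_def[of "(step ^^ n) f" F])

lemma step_power_mono:
  assumes "good F" "\<And>F. good F \<Longrightarrow> f F \<le> g F"
  shows "(step ^^ n) f F \<le> (step ^^ n) g F"
  using assms(1)
proof (induction n arbitrary: F)
  case (Suc n)
  then show ?case by (simp add: step_mono)
qed (simp add: assms(2))

lemma step_linear:
  "step (\<lambda>F. f F + g F) = (\<lambda>F. step f F + step g F)"
  "step (\<lambda>F. a * f F) = (\<lambda>F. a * step f F)"
  "step (\<lambda>F. a) = (\<lambda>F. a)"
  using m4 by (auto simp: step_def fun_eq_iff sum.distrib add_divide_distrib sum_distrib_left)

lemma step_power_linear:
  "(step ^^ n) (\<lambda>F. f F + g F) = (\<lambda>F. (step ^^ n) f F + (step ^^ n) g F)"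
  "(step ^^ n) (\<lambda>F. a * f F) = (\<lambda>F. a * (step ^^ n) f F)"
  "(step ^^ n) (\<lambda>F. a) = (\<lambda>F. a)"
  by (induction n) (simp_all add: step_linear)

text \<open>
  The free reduction of an edge word performs a lazy random walk on the free group of rank 2: out of
  four equally likely letters at most one shortens a reduced word.
\<close>

lemma step_weight:
  assumes "good F"
  shows "step weight F \<le> (1 - 1 / (4 * real m)) * weight F"
proof -
  let ?w = "\<lambda>F k. (1/2 :: real) ^ length (free_reduct (F k))"
  have col: "(\<Sum>c\<in>{0..<int m}. \<Sum>s\<in>UNIV. ?w (sdrop F (c, s)) k) \<le> (2 * real m
    - 1/2) * ?w F k" for k
  proof -
    define h where "h c = (\<Sum>s\<in>UNIV. ?w (sdrop F (c, s)) k)" for c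
    have per: "periodic h"
      unfolding periodic_def h_def free_reduct_sdrop[OF assms] dvd_shift by simp
    have far: "h c = 2 * ?w F k" if "c \<in> {k + 2..<k + int m}" for c
      using not_dvd_far[of k k c] not_dvd_far[of k "k + 1" c] that
      unfolding h_def free_reduct_sdrop[OF assms] by (simp add: UNIV_bool)
    have "{k..<k + int m} = insert k (insert (k + 1) {k + 2..<k + int m})"
      using m4 by auto
    then have "(\<Sum>c\<in>{0..<int m}. h c) = h k + h (k + 1) + (\<Sum>c\<in>{k + 2..<k + int m}. h c)"
      using sum_periodic[OF per, of k] by simp
    \<comment> \<open>Drops in the two columns of edge \<open>k\<close> apply each of the four
      letters once; the other \<open>m - 2\<close> columns leave the free reduct alone. The total
      factor is 7/2 + 2 (m - 2) = 2 m - 1/2.\<close>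
    also have "h k + h (k + 1) = (\<Sum>b\<in>UNIV. \<Sum>s\<in>UNIV. (1/2::real) ^ length (cancel (b, s) (free_reduct (F k))))"
      unfolding h_def free_reduct_sdrop[OF assms] using dvd_small by (simp add: UNIV_bool)
    also have "(\<Sum>c\<in>{k + 2..<k + int m}. h c) = (real m - 2) * (2 * ?w F k)"
      using far m4 by (simp add: of_nat_diff)
    finally show ?thesis
      using cancel_weight[of "free_reduct (F k)"] unfolding h_def by (simp add: algebra_simps)
  qed
  have "(\<Sum>c\<in>{0..<int m}. \<Sum>s\<in>UNIV. weight (sdrop F (c, s)))
      = (\<Sum>k\<in>{0..<int m}. \<Sum>c\<in>{0..<int m}. \<Sum>s\<in>UNIV. ?w (sdrop F (c, s)) k)"
    unfolding weight_def by (subst sum.swap[of _ _ "{0..<int m}"]) (subst sum.swap, rule refl)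
  also have "\<dots> \<le> (\<Sum>k\<in>{0..<int m}. (2 * real m - 1/2) * ?w F k)"
    by (intro sum_mono col)
  also have "\<dots> = (2 * real m - 1/2) * weight F"
    unfolding weight_def sum_distrib_left ..
  finally have "step weight F \<le> (2 * real m - 1/2) * weight F / (2 * real m)"
    unfolding step_def by (intro divide_right_mono) auto
  also have "\<dots> = (1 - 1 / (4 * real m)) * weight F"
    using m4 by (simp add: field_simps)
  finally show ?thesis .
qed

lemma step_power_weight:
  assumes "good F"
  shows "(step ^^ n) weight F \<le> (1 - 1 / (4 * real m)) ^ n * weight F"
  using assms
proof (induction n arbitrary: F)
  case (Suc n)
  let ?q = "1 - 1 / (4 * real m)"
  have "(step ^^ Suc n) weight F \<le> step (\<lambda>F. ?q ^ n * weight F) F"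
    using Suc by (simp add: step_mono)
  also have "\<dots> = ?q ^ n * step weight F"
    by (simp add: step_linear)
  also have "\<dots> \<le> ?q ^ n * (?q * weight F)"
    using m4 step_weight[OF Suc.prems] by (intro mult_left_mono) (auto simp: field_simps)
  finally show ?case by (simp add: algebra_simps)
qed simp

text \<open>Both heaps receive the same drops and stay \<open>near\<close>, so the bound of
  \<open>roof_count_near\<close> is averaged along the coupling.\<close>

lemma step_near:
  assumes "near A B"
  shows "\<bar>(step ^^ n) roof_count A - (step ^^ n) roof_count B\<bar> \<le> (step ^^ n) weight A
    + (step ^^ n) weight B"
  using assms
proof (induction n arbitrary: A B)
  case 0
  then show ?case by (simp add: roof_count_near)
next
  case (Suc n)
  let ?u = "(step ^^ n) roof_count" and ?v = "(step ^^ n) weight"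
  let ?S = "\<lambda>f F. \<Sum>c\<in>{0..<int m}. \<Sum>s\<in>UNIV. f (sdrop F (c, s))"
  have "\<bar>?S ?u A - ?S ?u B\<bar>
    \<le> (\<Sum>c\<in>{0..<int m}. \<Sum>s\<in>UNIV. \<bar>?u (sdrop A (c, s)) - ?u (sdrop B (c, s))\<bar>)"
    unfolding sum_subtractf[symmetric] by (intro order_trans[OF sum_abs] sum_mono sum_abs)
  also have "\<dots> \<le> (\<Sum>c\<in>{0..<int m}. \<Sum>s\<in>UNIV. ?v (sdrop A (c, s))
    + ?v (sdrop B (c, s)))"
    by (intro sum_mono Suc.IH near_sdrop Suc.prems)
  finally have "\<bar>?S ?u A - ?S ?u B\<bar> \<le> ?S ?v A + ?S ?v B"
    by (simp add: sum.distrib)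
  then have "\<bar>?S ?u A - ?S ?u B\<bar> / (2 * real m) \<le> (?S ?v A + ?S ?v B) / (2 * real m)"
    by (intro divide_right_mono) auto
  then show ?case
    unfolding step_power_Suc by (simp flip: diff_divide_distrib add_divide_distrib)
qed

abbreviation "empty_words \<equiv> \<lambda>_::int. [] :: (bool \<times> bool) list"

lemma good_empty: "good empty_words"
  by (simp add: good_def periodic_def column_consistent_def)

lemma near_empty: "near (sdrop empty_words x) empty_words"
proof -
  have "sdrop empty_words x = bottom x empty_words"
    by (cases x) (auto simp: sdrop_def exposed_shape spush_def bottom_def fun_eq_iff)
  then show ?thesis unfolding near_def using good_empty good_sdrop[OF good_empty, of x] by blast
qed

lemma weight_bounds: "0 \<le> weight F" "weight F \<le> real m"
proof -
  show "0 \<le> weight F" unfolding weight_def by (intro sum_nonneg) auto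
  have "weight F \<le> (\<Sum>k\<in>{0..<int m}. 1)"
    unfolding weight_def by (intro sum_mono power_le_one) auto
  then show "weight F \<le> real m" by simp
qed

text \<open>Conditioning on the first drop, an increment of the sequence is a mean of differences
  between \<open>n\<close>-step averages from a one-piece heap and from the empty heap. These decay
  geometrically, so the increments are summable.\<close>

lemma convergent_roof_count: "convergent (\<lambda>n. (step ^^ n) roof_count empty_words)"
proof -
  let ?u = "\<lambda>n. (step ^^ n) roof_count empty_words"
  define q where "q = 1 - 1 / (4 * real m)"
  have q: "0 \<le> q" "q < 1" using m4 by (auto simp: q_def field_simps)
  have diff: "\<bar>?u (Suc n) - ?u n\<bar> \<le> 2 * real m * q ^ n" for n
  proof -
    have bound: "(step ^^ n) weight F \<le> q ^ n * real m" if "good F" for F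
      using step_power_weight[OF that, of n, folded q_def] weight_bounds(2)[of F] q
      by (meson mult_left_mono order_trans zero_le_power)
    have each: "\<bar>(step ^^ n) roof_count (sdrop empty_words x) - ?u n\<bar>
      \<le> 2 * real m * q ^ n" for x
      using step_near[OF near_empty, of n x] bound[OF good_empty] bound[OF good_sdrop[OF good_empty], of x]
      by (simp add: algebra_simps)
    have "?u (Suc n) - ?u n = (\<Sum>c\<in>{0..<int m}. \<Sum>s\<in>UNIV. (step ^^ n) roof_count (sdrop empty_words (c, s)) - ?u n) / (2 * real m)"
      using m4 unfolding step_power_Suc by (simp add: sum_subtractf field_simps)
    also have "\<bar>\<dots>\<bar> \<le> (\<Sum>c\<in>{0..<int m}. \<Sum>s\<in>UNIV. \<bar>(step ^^ n) roof_count (sdrop empty_words (c, s)) - ?u n\<bar>) / (2 * real m)"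
      unfolding abs_divide abs_of_nonneg[OF mult_nonneg_nonneg[OF zero_le_numeral of_nat_0_le_iff]]
      by (intro divide_right_mono order_trans[OF sum_abs] sum_mono sum_abs) auto
    also have "\<dots> \<le> (\<Sum>c\<in>{0..<int m}. \<Sum>s\<in>(UNIV::bool set). 2 * real m * q ^ n) / (2 * real m)"
      by (intro divide_right_mono sum_mono each) auto
    also have "\<dots> = 2 * real m * q ^ n"
      using m4 by simp
    finally show ?thesis .
  qed
  have "summable (\<lambda>n. 2 * real m * q ^ n)"
    using q by (intro summable_mult summable_geometric) simp
  then have "summable (\<lambda>n. ?u (Suc n) - ?u n)"
    by (rule summable_comparison_test'[where N = 0]) (use diff in \<open>simp only: real_norm_def\<close>)
  then have "convergent (\<lambda>n. (\<Sum>i<n. ?u (Suc i) - ?u i))"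
    by (rule summable_iff_convergent[THEN iffD1])
  then have "convergent (\<lambda>n. (\<Sum>i<n. ?u (Suc i) - ?u i) + ?u 0)"
    by (intro convergent_add convergent_const)
  then show ?thesis
    unfolding sum_lessThan_telescope[of ?u] by (simp only: diff_add_cancel)
qed

section \<open>The potential bounds the limit\<close>

lemma step_shape:
  "step (\<lambda>F. f (shape F)) F = f (shape F) + drift f (shape F) / real m"
proof -
  have "(\<Sum>s\<in>UNIV. f (shape (sdrop F (c, s)))) = 2 * (gen f (shape F) c + f (shape F))" for c
    by (cases "snd (hd (F c))") (auto simp: UNIV_bool sdrop_def gen_def shape_sdrop)
  then have "step (\<lambda>F. f (shape F)) F
      = (\<Sum>c\<in>{0..<int m}. 2 * (gen f (shape F) c + f (shape F))) / (2 * real m)"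
    unfolding step_def by simp
  also have "\<dots> = f (shape F) + drift f (shape F) / real m"
    using m4 by (simp add: drift_def sum.distrib field_simps flip: sum_distrib_left)
  finally show ?thesis .
qed

text \<open>Only the last term is negative; its weights are small enough that each column
  contributes at least -1.\<close>

lemma potential_lower: "- real m \<le> potential E"
proof -
  define c where "c = min 5 (real m)"
  have c: "c = 4 \<or> c = 5"
    using m4 by (auto simp: c_def)
  have "(\<Sum>k\<in>{0..<int m}. - 1) \<le> potential E"
    unfolding potential_def Let_def c_def[symmetric]
  proof (intro sum_mono)
    fix k
    have "- 1 \<le> r + a * (x + x' + 5/4 * s + b - e * (n + n'))"
      if "0 \<le> r" "0 \<le> x" "0 \<le> x'" "0 \<le> s" "0 \<le> b" "n \<le> 1" "n' \<le> 1" "0 \<le> a" "a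
        \<le> 1" "0 \<le> e" "e \<le> 1/2"
      for r a x x' s b e n n' :: real
    proof -
      have "e * (n + n') \<le> 1/2 * 2"
        using that by (intro order_trans[OF mult_left_mono[of "n + n'" 2 e] mult_right_mono]) auto
      then have "- 1 \<le> x + x' + 5/4 * s + b - e * (n + n')"
        using that by simp
      then have "a * - 1 \<le> a * (x + x' + 5/4 * s + b - e * (n + n'))"
        using that by (intro mult_left_mono)
      then show ?thesis using that by simp
    qed
    then show "- 1 \<le> of_bool (exposed E k) + 1 / (2 * (3 - 11 / (8 * c))) *
       (of_bool (over E k 1) + of_bool (over E k (-1)) + 5/4 * of_bool (doubled E k)
        + 1 / c * of_bool (bridged E k)
        - 3 / (8 * c) * (of_bool (over E k 1 \<and> \<not> chained E k 1) + of_bool (over E k (-1)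
          \<and> \<not> chained E k (-1))))"
      using c by (elim disjE) simp_all
  qed
  then show ?thesis by simp
qed

text \<open>If the limit were larger, the mean potential would eventually fall by a fixed amount at
  every step, contrary to its lower bound.\<close>

lemma roof_count_limit_le:
  assumes "(\<lambda>n. (step ^^ n) roof_count empty_words) \<longlonglongrightarrow> l"
  shows "3.041 * l \<le> real m"
proof (rule ccontr)
  let ?u = "\<lambda>n. (step ^^ n) roof_count empty_words"
  let ?f = "\<lambda>F. potential (shape F)"
  let ?p = "\<lambda>n. (step ^^ n) ?f empty_words"
  assume "\<not> 3.041 * l \<le> real m"
  then have l: "real m / 3.041 < l" by simp
  have "?p (Suc n) \<le> ?p n + (1 + (- 3.041 / real m) * ?u n)" for n
  proof -
    have "step ?f F \<le> ?f F + (1 + (- 3.041 / real m) * roof_count F)" if "good F" for F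
    proof -
      have "periodic (shape F)"
        using that unfolding good_def periodic_def shape_def by simp
      then have "drift potential (shape F) / real m \<le> (real m - 3.041 * roofsize (shape F)) / real m"
        by (intro divide_right_mono drift_potential) auto
      then show ?thesis
        using m4 by (simp add: step_shape roof_count_def diff_divide_distrib)
    qed
    then have "(step ^^ n) (step ?f) empty_words \<le> (step ^^ n) (\<lambda>F. ?f F + (1
      + (- 3.041 / real m) * roof_count F)) empty_words"
      by (intro step_power_mono good_empty)
    then show ?thesis
      by (simp only: step_power_linear funpow_Suc_right o_def)
  qed
  then have dec: "?p (Suc n) - ?p n \<le> 1 - 3.041 / real m * ?u n" for n
    by (simp add: algebra_simps)
  \<comment> \<open>Half the gap, so that \<open>l - e\<close> equals
    \<open>m / 3.041 + e\<close>.\<close>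
  define e where "e = (l - real m / 3.041) / 2"
  have e: "0 < e" using l by (simp add: e_def)
  then have "eventually (\<lambda>n. ?u n > l - e) sequentially"
    using assms order_tendstoD(1) by fastforce
  then obtain N where N: "\<And>n. n \<ge> N \<Longrightarrow> ?u n > real m / 3.041 + e"
    unfolding eventually_sequentially e_def by (auto simp: field_simps)
  define d where "d = 3.041 / real m * e"
  have d: "0 < d" using e m4 by (simp add: d_def)
  have step: "?p (Suc n) \<le> ?p n - d" if "n \<ge> N" for n
  proof -
    have "3.041 / real m * (real m / 3.041 + e) \<le> 3.041 / real m * ?u n"
      using N[OF that] m4 by (intro mult_left_mono) auto
    also have "3.041 / real m * (real m / 3.041 + e) = 1 + d"
      using m4 by (simp add: d_def field_simps)
    finally show ?thesis using dec[of n] by simp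
  qed
  have down: "?p (N + j) \<le> ?p N - real j * d" for j
  proof (induction j)
    case (Suc j)
    then show ?case using step[of "N + j"] by (simp add: algebra_simps)
  qed simp
  have low: "?p n \<ge> - real m" for n
    using step_power_mono[OF good_empty, of "\<lambda>_. - real m" ?f n] potential_lower
    unfolding step_power_linear by simp
  obtain j where "?p N + real m < real j * d"
    using reals_Archimedean3[OF d, rule_format, of "?p N + real m"] by blast
  then show False
    using down[of j] low[of "N + j"] by linarith
qed

end

section \<open>Heaps and their edge words\<close>

text \<open>The strict order records that pieces in equal or adjacent columns of a heap have
  different heights; it makes the list unique.\<close>

definition edge_list :: "heap \<Rightarrow> int \<Rightarrow> int \<Rightarrow> piece list
  \<Rightarrow> bool" where
  "edge_list W j k ps \<longleftrightarrow> sorted_wrt (\<lambda>p q. fst q < fst p) ps \<and>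
     set ps = {p \<in> W. fst (snd p) = j \<or> fst (snd p) = k}"

lemma edge_list_inj: "sorted_wrt (\<lambda>p q. fst q < (fst p :: nat)) ps \<Longrightarrow> inj_on fst (set ps)"
  by (induction ps) auto

lemma edge_list_finite:
  assumes "edge_list W j k ps"
  shows "finite {h. \<exists>s. (h, j, s) \<in> W}" "finite {h. \<exists>s. (h, k, s) \<in> W}"
proof -
  have "{h. \<exists>s. (h, i, s) \<in> W} \<subseteq> fst ` set ps" if "i = j \<or> i = k" for i
  proof
    fix h assume "h \<in> {h. \<exists>s. (h, i, s) \<in> W}"
    then obtain s where "(h, i, s) \<in> W" by blast
    then have "(h, i, s) \<in> set ps" using assms that by (auto simp: edge_list_def)
    then show "h \<in> fst ` set ps" by (metis fst_conv imageI)
  qed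
  from finite_subset[OF this[of j]] finite_subset[OF this[of k]]
  show "finite {h. \<exists>s. (h, j, s) \<in> W}" "finite {h. \<exists>s. (h, k, s) \<in> W}"
    by simp_all
qed

lemma edge_list_empty:
  assumes "edge_list W j k []"
  shows "col_height W j = 0" "col_height W k = 0"
proof -
  have "{h. \<exists>s. (h, j, s) \<in> W} = {}" "{h. \<exists>s. (h, k, s) \<in> W} = {}"
    using assms by (auto simp: edge_list_def)
  then show "col_height W j = 0" "col_height W k = 0"
    unfolding col_height_def by simp_all
qed

lemma edge_list_top:
  assumes "edge_list W j k ((h, j, s) # ps)" "0 < h" "j \<noteq> k"
  shows "col_height W j = h" "col_height W k < h"
proof -
  note fin = edge_list_finite[OF assms(1)]
  have mem: "(h, j, s) \<in> W" using assms(1) by (auto simp: edge_list_def)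
  have le: "h' \<le> h" if "(h', j, s') \<in> W" for h' s'
  proof -
    have "(h', j, s') \<in> set ((h, j, s) # ps)" using assms(1) that by (auto simp: edge_list_def)
    then show ?thesis using assms(1) by (auto simp: edge_list_def)
  qed
  have lt: "h' < h" if "(h', k, s') \<in> W" for h' s'
  proof -
    have "(h', k, s') \<in> set ((h, j, s) # ps)" using assms(1) that by (auto simp: edge_list_def)
    then show ?thesis using assms(1,3) by (auto simp: edge_list_def)
  qed
  show "col_height W j = h"
    unfolding col_height_def using fin mem le by (intro Max_eqI) auto
  show "col_height W k < h"
    unfolding col_height_def using fin lt assms(2) by (subst Max_less_iff) auto
qed

lemma edge_list_sym: "edge_list W j k ps \<longleftrightarrow> edge_list W k j ps"
  by (auto simp: edge_list_def)

lemma le_col_height: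
  assumes "edge_list W j k ps" "(h, j, s) \<in> W"
  shows "h \<le> col_height W j"
  unfolding col_height_def using edge_list_finite[OF assms(1)] assms(2) by (intro Max_ge) auto

context four_columns
begin

text \<open>Existence of the lists carries the heap invariants (finite columns, different heights
  along an edge), so heaps need no separate validity predicate. Heights are positive so that
  \<open>col_height\<close> 0 means an empty column.\<close>

definition represents :: "heap \<Rightarrow> (int \<Rightarrow> (bool \<times> bool) list)
  \<Rightarrow> bool" where
  "represents W F \<longleftrightarrow> (\<forall>(h, k, s) \<in> W. 0 < h \<and> k \<in> {0..<int m}) \<and>
    (\<forall>e. \<exists>ps. edge_list W (e mod int m) ((e + 1) mod int m) ps \<and>
       F e = map (\<lambda>p. (fst (snd p) = e mod int m, snd (snd p))) ps)"

lemma mod_Suc_neq: "e mod int m \<noteq> (e + 1) mod int m"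
proof
  assume "e mod int m = (e + 1) mod int m"
  then have "int m dvd e - (e + 1)" by (simp add: mod_eq_dvd_iff)
  then show False using dvd_small by simp
qed

text \<open>A case rule linking the head of an edge word to the comparison of the two column
  heights: no piece, left column higher, right column higher.\<close>

lemma represents_edge:
  assumes "represents W F"
  obtains "F e = []" "edge_list W (e mod int m) ((e + 1) mod int m) []"
      "col_height W (e mod int m) = 0" "col_height W ((e + 1) mod int m) = 0"
  | s ps where "edge_list W (e mod int m) ((e
    + 1) mod int m) ((col_height W (e mod int m), e mod int m, s) # ps)"
      "F e = (True, s) # map (\<lambda>p. (fst (snd p) = e mod int m, snd (snd p))) ps"
      "col_height W ((e + 1) mod int m) < col_height W (e mod int m)"
  | s ps where "edge_list W (e mod int m) ((e + 1) mod int m) ((col_height W ((e + 1) mod int m), (e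
    + 1) mod int m, s) # ps)"
      "F e = (False, s) # map (\<lambda>p. (fst (snd p) = e mod int m, snd (snd p))) ps"
      "col_height W (e mod int m) < col_height W ((e + 1) mod int m)"
proof -
  obtain ps where ps: "edge_list W (e mod int m) ((e + 1) mod int m) ps"
      "F e = map (\<lambda>p. (fst (snd p) = e mod int m, snd (snd p))) ps"
    using assms unfolding represents_def by blast
  show ?thesis
  proof (cases ps)
    case Nil
    then show ?thesis using that(1) ps edge_list_empty[of W "e mod int m" "(e + 1) mod int m"] by simp
  next
    case (Cons p qs)
    obtain h k s where p: "p = (h, k, s)" by (cases p)
    have "(h, k, s) \<in> set ps" unfolding Cons p by simp
    then have "(h, k, s) \<in> W" and k: "k = e mod int m \<or> k = (e + 1) mod int m"
      using ps(1) unfolding edge_list_def by auto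
    then have h: "0 < h" using assms unfolding represents_def by auto
    show ?thesis
      using k
    proof
      assume k: "k = e mod int m"
      have el: "edge_list W (e mod int m) ((e + 1) mod int m) ((h, e mod int m, s) # qs)"
        using ps(1) unfolding Cons p k .
      show ?thesis
        using that(2)[of s qs] edge_list_top[OF el h mod_Suc_neq] el ps(2) unfolding Cons p k by simp
    next
      assume k: "k = (e + 1) mod int m"
      have el: "edge_list W (e mod int m) ((e + 1) mod int m) ((h, (e + 1) mod int m, s) # qs)"
        using ps(1) unfolding Cons p k .
      show ?thesis
        using that(3)[of s qs] edge_list_top[OF el[unfolded edge_list_sym[of W "e mod int m"]] h mod_Suc_neq[symmetric]]
          el ps(2) mod_Suc_neq[of e] unfolding Cons p k by simp
    qed
  qed
qed

lemma represents_left: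
  assumes "represents W F"
  shows "col_height W ((e + 1) mod int m) < col_height W (e mod int m) \<longleftrightarrow> F e \<noteq> []
    \<and> fst (hd (F e))"
  by (rule represents_edge[OF assms, of e]) auto

lemma represents_right:
  assumes "represents W F"
  shows "col_height W (e mod int m) < col_height W ((e + 1) mod int m) \<longleftrightarrow> F e \<noteq> []
    \<and> \<not> fst (hd (F e))"
  by (rule represents_edge[OF assms, of e]) auto

lemma represents_exposed:
  assumes "represents W F" "c \<in> {0..<int m}"
  shows "exposed (shape F) c \<longleftrightarrow>
    col_height W (col_left m c) < col_height W c \<and> col_height W (col_right m c) < col_height W c"
  using represents_left[OF assms(1), of c] represents_right[OF assms(1), of "c - 1"] assms(2)
  unfolding exposed_shape col_left_def col_right_def by auto

lemma represents_le:
  assumes "represents W F" "(h, k, s) \<in> W"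
  shows "h \<le> col_height W k"
proof -
  have "k mod int m = k" using assms unfolding represents_def by auto
  moreover obtain ps where "edge_list W (k mod int m) ((k + 1) mod int m) ps"
    using assms(1) unfolding represents_def by blast
  ultimately show ?thesis using le_col_height[of W k] assms(2) by auto
qed

lemma represents_unique:
  assumes "represents W F" "(h, k, s) \<in> W" "(h, k, t) \<in> W"
  shows "s = t"
proof -
  have k: "k mod int m = k" using assms unfolding represents_def by auto
  obtain ps where "edge_list W (k mod int m) ((k + 1) mod int m) ps"
    using assms(1) unfolding represents_def by blast
  then have "inj_on fst (set ps)" and "(h, k, s) \<in> set ps" "(h, k, t) \<in> set ps"
    using assms(2,3) edge_list_inj[of ps] k unfolding edge_list_def by (blast, auto)
  then show ?thesis using inj_onD[of fst "set ps" "(h, k, s)" "(h, k, t)"] by simp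
qed

lemma represents_top_sign:
  assumes "represents W F" "c \<in> {0..<int m}" "F c \<noteq> []" "fst (hd (F c))"
  shows "top_sign W c = snd (hd (F c))" "(col_height W c, c, snd (hd (F c))) \<in> W"
proof -
  have c: "c mod int m = c" using assms(2) by simp
  show mem: "(col_height W c, c, snd (hd (F c))) \<in> W"
    by (rule represents_edge[OF assms(1), of c]) (use assms(3,4) c in \<open>auto simp: edge_list_def\<close>)
  show "top_sign W c = snd (hd (F c))"
    unfolding top_sign_def
    by (rule the_equality, rule mem, rule represents_unique[OF assms(1) _ mem])
qed

text \<open>A removable piece is the top of its column and, heights along an edge being distinct,
  strictly above both neighbouring columns. So roof pieces correspond to exposed columns.\<close>

lemma roof_count_represents:
  assumes "represents W F"
  shows "real (card (roof m W)) = roof_count F"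
proof -
  let ?K = "{k \<in> {0..<int m}. exposed (shape F) k}"
  let ?p = "\<lambda>k. (col_height W k, k, snd (hd (F k)))"
  have "roof m W = ?p ` ?K"
  proof (intro set_eqI iffI)
    fix p assume p: "p \<in> roof m W"
    obtain h k s where hks: "p = (h, k, s)" by (cases p)
    have W: "(h, k, s) \<in> W" and k: "k \<in> {0..<int m}" and h: "0 < h"
      using p assms unfolding roof_def represents_def hks by auto
    have rem: "h' \<le> h" if "(h', k', s') \<in> W" "k' \<in> {col_left m k, k, col_right m k}" for h' k' s'
      using p that unfolding roof_def removable_def hks by force
    have kk: "k mod int m = k" using k by simp
    have top: "col_height W k = h"
    proof (rule antisym)
      show "h \<le> col_height W k" by (rule represents_le[OF assms W])
      have "col_height W k = 0 \<or> (\<exists>s. (col_height W k, k, s) \<in> W)"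
        unfolding col_height_def
        by (rule represents_edge[OF assms, of k])
           (use Max_in[of "insert 0 {h. \<exists>s. (h, k, s) \<in> W}"] edge_list_finite(1)[of W k] kk in auto)
      then show "col_height W k \<le> h" using rem by force
    qed
    have "col_height W (col_right m k) < col_height W k"
    proof (cases rule: represents_edge[OF assms, of k])
      case 1
      then have "{p \<in> W. fst (snd p) = k mod int m \<or> fst (snd p) = (k + 1) mod int m} = {}"
        unfolding edge_list_def by simp
      then show ?thesis using W kk by auto
    next
      case (2 s ps)
      then show ?thesis using kk by (simp add: col_right_def)
    next
      case (3 s ps)
      then have "(col_height W (col_right m k), col_right m k, s) \<in> W"
        unfolding edge_list_def col_right_def by auto
      then show ?thesis using rem 3(3) top kk by (fastforce simp: col_right_def)
    qed
    moreover have "col_height W (col_left m k) < col_height W k"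
    proof (cases rule: represents_edge[OF assms, of "k - 1"])
      case 1
      then have "{p \<in> W. fst (snd p) = (k - 1) mod int m \<or> fst (snd p) = (k - 1 + 1) mod int m} = {}"
        unfolding edge_list_def by simp
      then show ?thesis using W kk by auto
    next
      case (2 s ps)
      then have "(col_height W (col_left m k), col_left m k, s) \<in> W"
        unfolding edge_list_def col_left_def by auto
      then show ?thesis using rem 2(3) top kk by (fastforce simp: col_left_def)
    next
      case (3 s ps)
      then show ?thesis using kk by (simp add: col_left_def)
    qed
    ultimately have "exposed (shape F) k"
      using represents_exposed[OF assms k] by blast
    moreover have "s = snd (hd (F k))"
      using represents_unique[OF assms W] represents_top_sign(2)[OF assms k] \<open>exposed (shape F) k\<close> top
      unfolding exposed_shape by blast
    ultimately show "p \<in> ?p ` ?K"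
      using k top hks by blast
  next
    fix p assume "p \<in> ?p ` ?K"
    then obtain k where k: "k \<in> {0..<int m}" "exposed (shape F) k" and p: "p = ?p k" by blast
    have "p \<in> W"
      using represents_top_sign(2)[OF assms k(1)] k(2) unfolding exposed_shape p by blast
    moreover have "removable m W p"
      unfolding removable_def p using represents_exposed[OF assms k(1)] k(2) represents_le[OF assms]
      by (fastforce simp: not_less)
    ultimately show "p \<in> roof m W" unfolding roof_def by blast
  qed
  moreover have "inj_on ?p ?K" by (rule inj_onI) simp
  ultimately have "card (roof m W) = card ?K" by (simp add: card_image)
  also have "real (card ?K) = roof_count F"
    unfolding roof_count_def roofsize_def total_def by (simp add: Int_def)
  finally show ?thesis .
qed

lemma dvd_iff_mod:
  assumes "c \<in> {0..<int m}"
  shows "int m dvd e - c \<longleftrightarrow> e mod int m = c"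
  using assms mod_eq_dvd_iff[of e "int m" c] by auto

text \<open>An annihilated piece heads both edge lists of its column, since the column exceeds its
  neighbours. An added piece lies above everything in the three columns, so it becomes the head of
  both lists.\<close>

lemma represents_drop:
  assumes "represents W F" "c \<in> {0..<int m}"
  shows "represents (drop_piece m W (c, s)) (sdrop F (c, s))"
proof (cases "exposed (shape F) c \<and> snd (hd (F c)) \<noteq> s")
  case True
  let ?p = "(col_height W c, c, snd (hd (F c)))"
  have hd: "F c \<noteq> []" "fst (hd (F c))" "F (c - 1) \<noteq> []" "\<not> fst (hd (F (c - 1)))"
    using True unfolding exposed_shape by auto
  note ts = represents_top_sign[OF assms hd(1,2)]
  have W': "drop_piece m W (c, s) = W - {?p}"
    using True represents_exposed[OF assms] ts(1) unfolding drop_piece_def Let_def by auto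
  have F': "sdrop F (c, s) = pop c F"
    using True unfolding sdrop_def by simp
  have "\<exists>ps. edge_list (W - {?p}) (e mod int m) ((e + 1) mod int m) ps \<and>
       pop c F e = map (\<lambda>p. (fst (snd p) = e mod int m, snd (snd p))) ps" for e
  proof -
    obtain ps where ps: "edge_list W (e mod int m) ((e + 1) mod int m) ps"
      "F e = map (\<lambda>p. (fst (snd p) = e mod int m, snd (snd p))) ps"
      using assms(1) unfolding represents_def by blast
    show ?thesis
    proof (cases "e mod int m = c \<or> (e + 1) mod int m = c")
      case False
      then have "pop c F e = F e" "edge_list (W - {?p}) (e mod int m) ((e + 1) mod int m) ps"
        using ps(1) dvd_iff_mod[OF assms(2)] by (auto simp: pop_def edge_list_def)
      then show ?thesis using ps by auto
    next
      case True
      have pop: "pop c F e = tl (F e)"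
        using True dvd_iff_mod[OF assms(2), of e] dvd_iff_mod[OF assms(2), of "e + 1"] by (auto simp: pop_def)
      have "\<exists>s ps. edge_list W (e mod int m) ((e + 1) mod int m) ((col_height W c, c, s) # ps) \<and>
         tl (F e) = map (\<lambda>p. (fst (snd p) = e mod int m, snd (snd p))) ps"
        using True
      proof
        assume e: "e mod int m = c"
        have "col_height W ((e + 1) mod int m) < col_height W (e mod int m)"
          using represents_exposed[OF assms] \<open>exposed (shape F) c \<and> _\<close> e
          unfolding col_right_def by (metis mod_add_left_eq)
        then show ?thesis using e by (cases rule: represents_edge[OF assms(1), of e]) auto
      next
        assume e: "(e + 1) mod int m = c"
        then have "e mod int m = col_left m c"
          unfolding col_left_def by (metis add_diff_cancel_right' mod_diff_left_eq)
        then have "col_height W (e mod int m) < col_height W ((e + 1) mod int m)"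
          using represents_exposed[OF assms] \<open>exposed (shape F) c \<and> _\<close> e by simp
        then show ?thesis using e by (cases rule: represents_edge[OF assms(1), of e]) auto
      qed
      then obtain t qs where qs: "edge_list W (e mod int m) ((e + 1) mod int m) ((col_height W c, c, t) # qs)"
        "tl (F e) = map (\<lambda>p. (fst (snd p) = e mod int m, snd (snd p))) qs" by blast
      have "(col_height W c, c, t) \<in> W" using qs(1) unfolding edge_list_def by auto
      then have t: "(col_height W c, c, t) = ?p"
        using represents_unique[OF assms(1)] ts(2) by blast
      have "edge_list (W - {?p}) (e mod int m) ((e + 1) mod int m) qs"
      proof -
        let ?S = "{p \<in> W. fst (snd p) = e mod int m \<or> fst (snd p) = (e + 1) mod int m}"
        have "insert ?p (set qs) = ?S" "?p \<notin> set qs" "sorted_wrt (\<lambda>p q. fst q < fst p) qs"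
          using qs(1) unfolding t edge_list_def by auto
        moreover from this have "set qs = ?S - {?p}" by blast
        ultimately show ?thesis unfolding edge_list_def by blast
      qed
      then show ?thesis using qs(2) pop by auto
    qed
  qed
  then show ?thesis
    using assms(1) unfolding W' F' represents_def by auto
next
  case False
  define h where "h = max (col_height W (col_left m c)) (max (col_height W c) (col_height W (col_right m c)))
    + 1"
  have W': "drop_piece m W (c, s) = insert (h, c, s) W"
    using False represents_exposed[OF assms] represents_top_sign(1)[OF assms]
    unfolding drop_piece_def Let_def exposed_shape h_def by auto
  have F': "sdrop F (c, s) = spush c s F"
    using False unfolding sdrop_def by auto
  have "\<exists>ps. edge_list (insert (h, c, s) W) (e mod int m) ((e + 1) mod int m) ps \<and>
       spush c s F e = map (\<lambda>p. (fst (snd p) = e mod int m, snd (snd p))) ps" for e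
  proof -
    obtain ps where ps: "edge_list W (e mod int m) ((e + 1) mod int m) ps"
      "F e = map (\<lambda>p. (fst (snd p) = e mod int m, snd (snd p))) ps"
      using assms(1) unfolding represents_def by blast
    show ?thesis
    proof (cases "e mod int m = c \<or> (e + 1) mod int m = c")
      case False
      then have "spush c s F e = F e" "edge_list (insert (h, c, s) W) (e mod int m) ((e + 1) mod int m) ps"
        using ps(1) dvd_iff_mod[OF assms(2)] by (auto simp: spush_def edge_list_def)
      then show ?thesis using ps by auto
    next
      case True
      have push: "spush c s F e = (e mod int m = c, s) # F e"
        using True dvd_iff_mod[OF assms(2), of e] dvd_iff_mod[OF assms(2), of "e + 1"] mod_Suc_neq[of e]
          by (auto simp: spush_def)
      have nb: "e mod int m \<in> {col_left m c, c}" "(e + 1) mod int m \<in> {c, col_right m c}"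
        using True unfolding col_left_def col_right_def
        by (metis add_diff_cancel_right' insertCI mod_diff_left_eq, metis insertCI mod_add_left_eq)
      have lt: "fst p < h" if "p \<in> set ps" for p
      proof -
        obtain h' k' s' where p: "p = (h', k', s')" by (cases p)
        have "p \<in> W" "k' \<in> {col_left m c, c, col_right m c}"
          using that ps(1) nb unfolding edge_list_def p by auto
        then show ?thesis using represents_le[OF assms(1), of h' k' s'] unfolding p h_def by auto
      qed
      have "edge_list (insert (h, c, s) W) (e mod int m) ((e + 1) mod int m) ((h, c, s) # ps)"
        using ps(1) lt True unfolding edge_list_def by auto
      then show ?thesis using push ps(2) by (intro exI[of _ "(h, c, s) # ps"]) auto
    qed
  qed
  then show ?thesis
    using assms unfolding W' F' represents_def h_def by auto
qed

lemma represents_empty: "represents {} empty_words"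
  by (auto simp: represents_def edge_list_def)

end

section \<open>From the process to averages over words\<close>

context prob_space
begin

text \<open>The first \<open>n\<close> choices form a uniform word over \<open>S\<close>, up to a
  null set. Countability of the letters makes the word measurable.\<close>

lemma expectation_finite_words:
  fixes X :: "nat \<Rightarrow> 'a \<Rightarrow> 'b :: countable" and g :: "'b list \<Rightarrow> real"
  assumes indep: "indep_vars (\<lambda>_. count_space UNIV) X UNIV"
    and dist: "\<And>n. distr M (count_space UNIV) (X n) = measure_pmf (pmf_of_set S)"
    and S: "finite S" "S \<noteq> {}"
  shows "expectation (\<lambda>\<omega>. g (map (\<lambda>i. X i \<omega>) [0..<n]))
    = (\<Sum>xs | set xs \<subseteq> S \<and> length xs = n. g xs) / real (card S) ^ n"
proof -
  let ?L = "{xs. set xs \<subseteq> S \<and> length xs = n}"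
  define Y where "Y \<omega> = map (\<lambda>i. X i \<omega>) [0..<n]" for \<omega>
  have rv: "X i \<in> M \<rightarrow>\<^sub>M count_space UNIV" for i
    using indep unfolding indep_vars_def by auto
  have fiber: "Y -` {xs} \<inter> space M = (if length xs
    = n then {\<omega> \<in> space M. \<forall>i<n. X i \<omega> = xs ! i} else {})" for xs
  proof -
    have "Y \<omega> = xs \<longleftrightarrow> length xs = n \<and> (\<forall>i<n. X i \<omega>
      = xs ! i)" for \<omega>
      unfolding Y_def by (subst list_eq_iff_nth_eq) auto
    then show ?thesis by auto
  qed
  have meas: "Y \<in> M \<rightarrow>\<^sub>M count_space UNIV"
  proof (subst measurable_count_space_eq_countable)
    have ev: "{\<omega> \<in> space M. \<forall>i<n. X i \<omega> = xs ! i} \<in> sets M" for xs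
    proof (rule sets.sets_Collect_countable_All)
      fix i
      have "{\<omega> \<in> space M. i < n \<longrightarrow> X i \<omega> = xs ! i}
        = (if i < n then X i -` {xs ! i} \<inter> space M else space M)"
        by auto
      also have "\<dots> \<in> sets M"
        using measurable_sets[OF rv[of i], of "{xs ! i}"] by simp
      finally show "{\<omega> \<in> space M. i < n \<longrightarrow> X i \<omega> = xs ! i} \<in> sets M" .
    qed
    have "Y -` {xs} \<inter> space M \<in> sets M" for xs
      unfolding fiber by (cases "length xs
        = n") (simp_all only: ev simp_thms if_True if_False sets.empty_sets)
    then show "Y \<in> space M \<rightarrow> UNIV
      \<and> (\<forall>a\<in>UNIV. Y -` {a} \<inter> space M \<in> sets M)"
      by blast
  qed (rule countableI_type)
  have single: "prob (X i -` {a} \<inter> space M) = 1 / real (card S)" if "a \<in> S" for i a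
  proof -
    have "prob (X i -` {a} \<inter> space M) = measure (distr M (count_space UNIV) (X i)) {a}"
      using rv by (subst measure_distr) auto
    also have "\<dots> = 1 / real (card S)"
      unfolding dist using S that by (simp add: measure_pmf_single)
    finally show ?thesis .
  qed
  have word: "prob (Y -` {xs} \<inter> space M) = 1 / real (card S) ^ n" if "xs \<in> ?L" for xs
  \<comment> \<open>The product formula for independent events needs a nonempty index set.\<close>
  proof (cases "n = 0")
    case True
    then show ?thesis using that by (simp add: fiber prob_space)
  next
    case False
    have "Y -` {xs} \<inter> space M = (\<Inter>i\<in>{..<n}. X i -` {xs ! i} \<inter> space M)"
      using that False unfolding fiber by auto
    also have "prob \<dots> = (\<Prod>i\<in>{..<n}. prob (X i -` {xs ! i} \<inter> space M))"
      using False by (intro indep_varsD[OF indep]) auto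
    also have "\<dots> = (\<Prod>i\<in>{..<n}. 1 / real (card S))"
      using that by (intro prod.cong single) (auto simp: subset_iff)
    finally show ?thesis by (simp add: power_one_over)
  qed
  have "AE \<omega> in M. X i \<omega> \<in> S" for i
  proof -
    have "AE x in distr M (count_space UNIV) (X i). x \<in> S"
      unfolding dist using S by (simp add: AE_measure_pmf_iff)
    then show ?thesis using rv by (subst (asm) AE_distr_iff) auto
  qed
  then have "AE \<omega> in M. \<forall>i. X i \<omega> \<in> S"
    by (simp add: AE_all_countable)
  then have "AE \<omega> in M. g (Y \<omega>)
    = (\<Sum>xs\<in>?L. g xs * indicator (Y -` {xs} \<inter> space M) \<omega>)"
  proof (rule AE_mp, intro AE_I2 impI)
    fix \<omega> assume "\<omega> \<in> space M" "\<forall>i. X i \<omega> \<in> S"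
    then have "Y \<omega> \<in> ?L" by (auto simp: Y_def)
    have "(\<Sum>xs\<in>?L. g xs * indicator (Y -` {xs} \<inter> space M) \<omega>) = (\<Sum>xs\<in>?L.
      if Y \<omega> = xs then g xs else 0)"
      using \<open>\<omega> \<in> space M\<close> by (intro sum.cong) auto
    then show "g (Y \<omega>) = (\<Sum>xs\<in>?L. g xs * indicator (Y -` {xs} \<inter> space M) \<omega>)"
      using \<open>Y \<omega> \<in> ?L\<close> S(1) by (simp add: finite_lists_length_eq)
  qed
  moreover have "(\<lambda>\<omega>. g (Y \<omega>)) \<in> borel_measurable M"
    using meas by (rule measurable_compose) simp
  moreover have sets: "Y -` {xs} \<inter> space M \<in> sets M" for xs
    using meas by (rule measurable_sets) simp
  ultimately have "expectation (\<lambda>\<omega>. g (Y \<omega>))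
    = expectation (\<lambda>\<omega>. \<Sum>xs\<in>?L. g xs * indicator (Y -` {xs} \<inter> space M) \<omega>)"
    by (intro integral_cong_AE) auto
  also have "\<dots> = (\<Sum>xs\<in>?L. g xs * prob (Y -` {xs} \<inter> space M))"
    using sets by (subst Bochner_Integration.integral_sum) (auto simp: less_top[symmetric])
  also have "\<dots> = (\<Sum>xs\<in>?L. g xs / real (card S) ^ n)"
    by (intro sum.cong) (simp_all add: word)
  finally show ?thesis
    unfolding Y_def by (simp add: sum_divide_distrib)
qed

end

context four_columns
begin

lemma step_power_words:
  "(step ^^ n) f F = (\<Sum>xs | set xs \<subseteq> {0..<int m} \<times> UNIV \<and> length xs
    = n. f (foldl sdrop F xs)) / (2 * real m) ^ n"
proof (induction n arbitrary: F)
  case 0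
  have "{xs. set xs \<subseteq> {0..<int m} \<times> (UNIV :: bool set) \<and> length xs = 0} = {[]}" by auto
  then show ?case by simp
next
  case (Suc n)
  let ?S = "{0..<int m} \<times> (UNIV :: bool set)"
  let ?L = "{xs. set xs \<subseteq> ?S \<and> length xs = n}"
  have "(\<Sum>xs | set xs \<subseteq> ?S \<and> length xs = Suc n. f (foldl sdrop F xs))
      = (\<Sum>(xs, x)\<in>?L \<times> ?S. f (foldl sdrop (sdrop F x) xs))"
    unfolding lists_length_Suc_eq
    by (subst sum.reindex) (auto simp: inj_on_def case_prod_unfold)
  also have "\<dots> = (\<Sum>x\<in>?S. \<Sum>xs\<in>?L. f (foldl sdrop (sdrop F x) xs))"
    unfolding sum.cartesian_product[symmetric] by (rule sum.swap)
  also have "\<dots> = (\<Sum>c\<in>{0..<int m}. \<Sum>s\<in>UNIV. \<Sum>xs\<in>?L. f (foldl sdrop (sdrop F (c, s)) xs))"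
  proof -
    have "sum h ?S = (\<Sum>c\<in>{0..<int m}. \<Sum>s\<in>UNIV. h (c, s))" for h :: "int \<times> bool
      \<Rightarrow> real"
      by (simp add: sum.cartesian_product)
    then show ?thesis .
  qed
  finally show ?case
    unfolding step_power_Suc Suc.IH by (simp add: sum_divide_distrib[symmetric])
qed

lemma roof_count_foldl:
  assumes "set xs \<subseteq> {0..<int m} \<times> UNIV"
  shows "real (card (roof m (foldl (drop_piece m) {} xs))) = roof_count (foldl sdrop empty_words xs)"
proof -
  have "represents (foldl (drop_piece m) {} xs) (foldl sdrop empty_words xs)"
    using assms
  proof (induction xs rule: rev_induct)
    case (snoc x xs)
    then show ?case by (cases x) (auto intro: represents_drop)
  qed (simp add: represents_empty)
  then show ?thesis by (rule roof_count_represents)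
qed

lemma expectation_roof:
  assumes "signed_heap_process m M W"
  shows "prob_space.expectation M (\<lambda>\<omega>. real (card (roof m (W n \<omega>))))
    = (step ^^ n) roof_count empty_words"
proof -
  interpret prob_space M using assms unfolding signed_heap_process_def by blast
  let ?S = "heap_columns m \<times> (UNIV :: bool set)"
  obtain X where X: "indep_vars (\<lambda>_. count_space UNIV) X UNIV"
      "\<And>n. distr M (count_space UNIV) (X n) = measure_pmf (pmf_of_set ?S)"
      "\<And>\<omega>. \<omega> \<in> space M \<Longrightarrow> W 0 \<omega> = {}"
      "\<And>n \<omega>. \<omega> \<in> space M \<Longrightarrow> W (Suc n) \<omega>
        = drop_piece m (W n \<omega>) (X n \<omega>)"
    using assms unfolding signed_heap_process_def by blast
  have S: "finite ?S" "?S \<noteq> {}" "real (card ?S) = 2 * real m"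
    using m4 by (auto simp: heap_columns_def card_cartesian_product)
  have W: "W n \<omega> = foldl (drop_piece m) {} (map (\<lambda>i. X i \<omega>) [0..<n])"
    if "\<omega> \<in> space M" for n \<omega>
    using X(3,4)[OF that] by (induction n) simp_all
  have "expectation (\<lambda>\<omega>. real (card (roof m (W n \<omega>))))
      = expectation (\<lambda>\<omega>. real (card (roof m (foldl (drop_piece m) {} (map (\<lambda>i. X i \<omega>) [0..<n])))))"
    by (intro Bochner_Integration.integral_cong) (simp_all add: W)
  also have "\<dots> = (\<Sum>xs | set xs \<subseteq> ?S \<and> length xs
    = n. real (card (roof m (foldl (drop_piece m) {} xs)))) / (2 * real m) ^ n"
    by (subst expectation_finite_words[OF X(1,2) S(1,2)]) (simp only: S(3))
  also have "\<dots> = (step ^^ n) roof_count empty_words"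
    unfolding step_power_words heap_columns_def
    by (intro arg_cong2[where f = "(/)"] sum.cong) (auto simp: roof_count_foldl)
  finally show ?thesis .
qed

end

theorem theorem1p1:
  fixes m :: nat and M :: "'a measure" and W :: "nat \<Rightarrow> 'a \<Rightarrow> heap"
  assumes "m \<ge> 4"
    and "signed_heap_process m M W"
  shows "\<exists>L::real.
    (\<lambda>n. (1 / real m) * prob_space.expectation M (\<lambda>\<omega>. real (card (roof m (W n \<omega>))))) \<longlonglongrightarrow> L
    \<and> L \<le> 0.32893"
proof -
  interpret four_columns m by unfold_locales (rule assms(1))
  obtain l where l: "(\<lambda>n. (step ^^ n) roof_count empty_words) \<longlonglongrightarrow> l"
    using convergent_roof_count unfolding convergent_def by blast
  \<comment> \<open>1 / 3.041 = 0.32883..., slightly below the claimed constant.\<close>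
  have "1 / real m * l \<le> 0.32893"
    using roof_count_limit_le[OF l] assms(1) by (simp add: field_simps)
  moreover have "(\<lambda>n. 1 / real m * (step ^^ n) roof_count empty_words) \<longlonglongrightarrow> 1 / real m * l"
    by (intro tendsto_mult_left l)
  ultimately show ?thesis
    unfolding expectation_roof[OF assms(2)] by blast
qed

end
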